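(* Let $n\ge 1$ and $k\ge 1$ be integers, let $p\in\mathbb{R}[x_1,\ldots,x_n]$ be a real quadratic form in $n$ variables, and let $G_n=x_1^2+x_2^2+\cdots+x_n^2$. Suppose that at least one of the following holds: 1. $p$ is symmetric (i.e. invariant under all permutations of the variables $x_1,\ldots,x_n$); 2. $k=2$; 3. $n=4$ and $k=3$. Then the following equivalence holds: there exists a nonnegative integer $r$ such that $G_n^r\,p$ is a sum of squares of $k$-nomials if and only if $p$ itself is a sum of squares of $k$-nomials.
   Context: A $k$-nomial is a polynomial of the form $\alpha_1 m_1+\cdots+\alpha_k m_k$ with $\alpha_1,\ldots,\alpha_k\in\mathbb{R}$ (possibly zero) and $m_1,\ldots,m_k$ monomials in $x_1,\ldots,x_n$; thus every $(k-1)$-nomial is also a $k$-nomial. A polynomial is a sum of squares of $k$-nomials (so$k$s) if it is a finite sum of squares of $k$-nomials. *)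

theory Defs
  imports Complex_Main "HOL-Library.Poly_Mapping" "HOL-Combinatorics.Permutations"
begin

text \<open>
  Real polynomials as finitely supported maps from exponent vectors to coefficients, with the
  convolution product of \<^theory>\<open>HOL-Library.Poly_Mapping\<close>. The variables
  \<open>x\<^sub>1, \<dots>, x\<^sub>n\<close> are the indices \<open>0, \<dots>, n - 1\<close>; membership in the polynomial ring in \<open>n\<close>
  variables is expressed by restricting the exponent vectors to these indices.
\<close>

type_synonym monomial = "nat \<Rightarrow>\<^sub>0 nat"
type_synonym rpoly = "monomial \<Rightarrow>\<^sub>0 real"

definition monomial_in :: "nat \<Rightarrow> monomial \<Rightarrow> bool" where
  "monomial_in n m \<longleftrightarrow> Poly_Mapping.keys m \<subseteq> {..<n}"

definition monomial_degree :: "monomial \<Rightarrow> nat" where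
  "monomial_degree m = (\<Sum>i\<in>Poly_Mapping.keys m. Poly_Mapping.lookup m i)"

definition var :: "nat \<Rightarrow> rpoly" where
  "var i = Poly_Mapping.single (Poly_Mapping.single i 1) 1"

text \<open>The zero polynomial counts as a quadratic form.\<close>

definition quadratic_form :: "nat \<Rightarrow> rpoly \<Rightarrow> bool" where
  "quadratic_form n p \<longleftrightarrow>
     (\<forall>m\<in>Poly_Mapping.keys p. monomial_in n m \<and> monomial_degree m = 2)"

definition rename_monomial :: "(nat \<Rightarrow> nat) \<Rightarrow> monomial \<Rightarrow> monomial" where
  "rename_monomial \<sigma> m =
     (\<Sum>i\<in>Poly_Mapping.keys m. Poly_Mapping.single (\<sigma> i) (Poly_Mapping.lookup m i))"

text \<open>The substitution \<open>x\<^sub>i \<mapsto> x\<^bsub>\<sigma> i\<^esub>\<close>.\<close>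

definition rename_vars :: "(nat \<Rightarrow> nat) \<Rightarrow> rpoly \<Rightarrow> rpoly" where
  "rename_vars \<sigma> p =
     (\<Sum>m\<in>Poly_Mapping.keys p. Poly_Mapping.single (rename_monomial \<sigma> m) (Poly_Mapping.lookup p m))"

definition symmetric_poly :: "nat \<Rightarrow> rpoly \<Rightarrow> bool" where
  "symmetric_poly n p \<longleftrightarrow> (\<forall>\<sigma>. \<sigma> permutes {..<n} \<longrightarrow> rename_vars \<sigma> p = p)"

text \<open>The coefficients may vanish and the monomials need not be distinct.\<close>

definition k_nomial :: "nat \<Rightarrow> nat \<Rightarrow> rpoly \<Rightarrow> bool" where
  "k_nomial n k q \<longleftrightarrow>
     (\<exists>(\<alpha> :: nat \<Rightarrow> real) (m :: nat \<Rightarrow> monomial).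
        (\<forall>j<k. monomial_in n (m j)) \<and> q = (\<Sum>j<k. Poly_Mapping.single (m j) (\<alpha> j)))"

definition sum_of_squares_of_k_nomials :: "nat \<Rightarrow> nat \<Rightarrow> rpoly \<Rightarrow> bool" where
  "sum_of_squares_of_k_nomials n k p \<longleftrightarrow>
     (\<exists>(N :: nat) (q :: nat \<Rightarrow> rpoly). (\<forall>j<N. k_nomial n k (q j)) \<and> p = (\<Sum>j<N. q j ^ 2))"

definition G :: "nat \<Rightarrow> rpoly" where
  "G n = (\<Sum>i<n. var i ^ 2)"

end

theory Submission
  imports Defs "HOL-Analysis.Analysis"
begin

text \<open>
  Split a polynomial \<open>f\<close> according to the set \<open>u\<close> of variables occurring to an odd power, evaluate
  each part at a real point \<open>z\<close>, and add the values with weights \<open>w u\<close>. Since \<open>G n\<close> has only even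
  monomials, multiplying \<open>f\<close> by \<open>G n\<close> merely multiplies the result by the value of \<open>G n\<close> at \<open>z\<close>.
  If all \<open>k \<times> k\<close> matrices with entries \<open>w (u\<^sub>i \<triangle> u\<^sub>j)\<close> are positive semidefinite, the functional is
  nonnegative on squares of \<open>k\<close>-nomials, hence on every form \<open>p\<close> for which some \<open>G n ^ r * p\<close> is a sum
  of such squares. So it suffices to cut out the quadratic sums of squares of \<open>k\<close>-nomials by
  functionals of this kind.

  For \<open>k = 2\<close> the weights \<open>- sgn a\<^sub>i\<^sub>j\<close> show that replacing all off-diagonal coefficients by
  \<open>- \<bar>a\<^sub>i\<^sub>j\<bar>\<close> leaves a positive semidefinite matrix, which makes the form scaled diagonally dominant.
  For symmetric forms the weights \<open>k - 1\<close> at the empty set and \<open>- 1\<close> elsewhere give the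
  one inequality beyond positive semidefiniteness. For \<open>n = 4\<close>, \<open>k = 3\<close>, a separating functional
  that is extremal and not positive semidefinite has all its \<open>3 \<times> 3\<close> principal minors equal to zero;
  after rescaling the variables its entries depend only on the partition of the four indices into
  pairs that \<open>{i, j}\<close> determines, so it comes from a weight on the Klein four-group of even subsets
  modulo complementation.
\<close>

section \<open>Quadratic forms and parity-weighted evaluation\<close>

definition parity_class :: "monomial \<Rightarrow> nat set" where
  "parity_class m = {i. odd (Poly_Mapping.lookup m i)}"

definition eval_monomial :: "nat \<Rightarrow> (nat \<Rightarrow> real) \<Rightarrow> monomial \<Rightarrow> real" where
  "eval_monomial n z m = (\<Prod>i<n. z i ^ Poly_Mapping.lookup m i)"

definition weighted_eval :: "nat \<Rightarrow> (nat set \<Rightarrow> real) \<Rightarrow> (nat \<Rightarrow> real) \<Rightarrow> rpoly \<Rightarrow> real" where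
  "weighted_eval n w z f =
     (\<Sum>m\<in>Poly_Mapping.keys f. Poly_Mapping.lookup f m * (w (parity_class m) * eval_monomial n z m))"

definition quad_monomial :: "nat \<Rightarrow> nat \<Rightarrow> monomial" where
  "quad_monomial i j = Poly_Mapping.single i 1 + Poly_Mapping.single j 1"

text \<open>The sum runs over ordered pairs, so an off-diagonal monomial receives
  \<open>a i j + a j i\<close>.\<close>

definition quad_poly :: "nat \<Rightarrow> (nat \<Rightarrow> nat \<Rightarrow> real) \<Rightarrow> rpoly" where
  "quad_poly n a = (\<Sum>i<n. \<Sum>j<n. Poly_Mapping.single (quad_monomial i j) (a i j))"

section \<open>Parity classes and parity-weighted evaluation\<close>

lemma sum_singles_keys:
  fixes f :: "'a \<Rightarrow>\<^sub>0 'b::comm_monoid_add"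
  shows "(\<Sum>m\<in>Poly_Mapping.keys f. Poly_Mapping.single m (Poly_Mapping.lookup f m)) = f"
  by (rule poly_mapping_eqI)
     (auto simp: lookup_sum lookup_single when_def sum.delta' in_keys_iff)

lemma parity_class_add: "parity_class (m + m') = sym_diff (parity_class m) (parity_class m')"
  by (auto simp: parity_class_def lookup_add)

lemma eval_monomial_add: "eval_monomial n z (m + m') = eval_monomial n z m * eval_monomial n z m'"
  by (simp add: eval_monomial_def lookup_add power_add prod.distrib)

lemma parity_class_single_1: "parity_class (Poly_Mapping.single i 1) = {i}"
  by (auto simp: parity_class_def lookup_single when_def)

lemma eval_monomial_single_1:
  assumes "i < n"
  shows "eval_monomial n z (Poly_Mapping.single i 1) = z i"
proof -
  have "eval_monomial n z (Poly_Mapping.single i 1) = (\<Prod>j<n. if j = i then z i else 1)"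
    unfolding eval_monomial_def by (rule prod.cong) (auto simp: lookup_single when_def)
  then show ?thesis using assms by simp
qed

lemma parity_class_quad: "parity_class (quad_monomial i j) = (if i = j then {} else {i, j})"
  by (auto simp: quad_monomial_def parity_class_add parity_class_single_1 simp del: One_nat_def)

lemma eval_monomial_quad:
  "i < n \<Longrightarrow> j < n \<Longrightarrow> eval_monomial n z (quad_monomial i j) = z i * z j"
  by (simp add: quad_monomial_def eval_monomial_add eval_monomial_single_1 del: One_nat_def)

lemma monomial_in_single: "i < n \<Longrightarrow> monomial_in n (Poly_Mapping.single i e)"
  by (simp add: monomial_in_def)

lemma parity_class_subset: "monomial_in n m \<Longrightarrow> parity_class m \<subseteq> {..<n}"
  by (auto simp: monomial_in_def parity_class_def in_keys_iff) (metis in_keys_iff lessThan_iff odd_pos not_gr_zero subsetD)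

lemma quad_monomial_commute: "quad_monomial i j = quad_monomial j i"
  by (simp add: quad_monomial_def add.commute)

lemma quad_monomial_eq_iff:
  "quad_monomial i j = quad_monomial k l \<longleftrightarrow> (i = k \<and> j = l) \<or> (i = l \<and> j = k)"
proof
  assume eq: "quad_monomial i j = quad_monomial k l"
  have "((1::nat) when i = x) + (1 when j = x) = (1 when k = x) + (1 when l = x)" for x
    using arg_cong[OF eq, of "\<lambda>m. Poly_Mapping.lookup m x"]
    by (simp add: quad_monomial_def lookup_add lookup_single)
  from this[of i] this[of j] this[of k] this[of l]
  show "(i = k \<and> j = l) \<or> (i = l \<and> j = k)"
    by (auto simp: when_def split: if_splits)
qed (auto simp: quad_monomial_commute)

lemma weighted_eval_superset:
  assumes "finite A" "Poly_Mapping.keys f \<subseteq> A"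
  shows "weighted_eval n w z f =
    (\<Sum>m\<in>A. Poly_Mapping.lookup f m * (w (parity_class m) * eval_monomial n z m))"
  unfolding weighted_eval_def using assms
  by (intro sum.mono_neutral_left) (auto simp: in_keys_iff)

lemma weighted_eval_add:
  "weighted_eval n w z (f + g) = weighted_eval n w z f + weighted_eval n w z g"
proof -
  let ?A = "Poly_Mapping.keys f \<union> Poly_Mapping.keys g"
  show ?thesis
    using keys_add[of f g]
    by (simp add: weighted_eval_superset[of ?A] lookup_add distrib_right sum.distrib)
qed

lemma weighted_eval_zero: "weighted_eval n w z 0 = 0"
  by (simp add: weighted_eval_def)

lemma weighted_eval_sum: "weighted_eval n w z (sum f A) = (\<Sum>x\<in>A. weighted_eval n w z (f x))"
  by (induction A rule: infinite_finite_induct) (simp_all add: weighted_eval_zero weighted_eval_add)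

lemma weighted_eval_single:
  "weighted_eval n w z (Poly_Mapping.single m c) = c * (w (parity_class m) * eval_monomial n z m)"
  by (simp add: weighted_eval_def)

text \<open>An even factor leaves all parity classes unchanged, so the weights stay and only its
  value at \<open>z\<close> comes out.\<close>

lemma weighted_eval_even_monomial_mult:
  assumes "parity_class m = {}"
  shows "weighted_eval n w z (Poly_Mapping.single m 1 * f) = eval_monomial n z m * weighted_eval n w z f"
proof -
  have "Poly_Mapping.single m 1 * f =
      (\<Sum>m'\<in>Poly_Mapping.keys f. Poly_Mapping.single (m + m') (Poly_Mapping.lookup f m'))"
    by (subst sum_singles_keys[of f, symmetric]) (simp add: sum_distrib_left mult_single)
  then have "weighted_eval n w z (Poly_Mapping.single m 1 * f) =
      (\<Sum>m'\<in>Poly_Mapping.keys f. Poly_Mapping.lookup f m' *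
        (w (parity_class m') * (eval_monomial n z m * eval_monomial n z m')))"
    by (simp add: weighted_eval_sum weighted_eval_single parity_class_add assms eval_monomial_add
        del: One_nat_def)
  then show ?thesis
    by (simp add: weighted_eval_def sum_distrib_left mult_ac)
qed

lemma G_alt: "G n = (\<Sum>i<n. Poly_Mapping.single (quad_monomial i i) 1)"
  by (simp add: G_def var_def power2_eq_square mult_single quad_monomial_def)

lemma weighted_eval_G_power_mult:
  "weighted_eval n w z (G n ^ r * f) = (\<Sum>i<n. (z i)\<^sup>2) ^ r * weighted_eval n w z f"
proof (induction r)
  case (Suc r)
  have "G n ^ Suc r * f = (\<Sum>i<n. Poly_Mapping.single (quad_monomial i i) 1 * (G n ^ r * f))"
    by (simp add: G_alt[of n] sum_distrib_right mult.assoc)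
  also have "weighted_eval n w z \<dots> = (\<Sum>i<n. (z i)\<^sup>2 * weighted_eval n w z (G n ^ r * f))"
    unfolding weighted_eval_sum
    by (intro sum.cong refl, subst weighted_eval_even_monomial_mult)
       (auto simp: parity_class_quad eval_monomial_quad power2_eq_square)
  finally show ?case by (simp only: Suc.IH sum_distrib_right[symmetric] power_Suc mult.assoc)
qed simp

lemma weighted_eval_quad_poly:
  "weighted_eval n w z (quad_poly n a) =
     (\<Sum>i<n. \<Sum>j<n. a i j * w (if i = j then {} else {i, j}) * z i * z j)"
  by (simp add: quad_poly_def weighted_eval_sum weighted_eval_single parity_class_quad
      eval_monomial_quad mult.assoc)

text \<open>\<open>w\<close> is a positive definite function on the group of subsets under symmetric
  difference, tested on \<open>k\<close> points only. The \<open>u i\<close> may repeat, as the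
  monomials of a \<open>k\<close>-nomial may share a parity class.\<close>

definition psd_weight :: "nat \<Rightarrow> nat \<Rightarrow> (nat set \<Rightarrow> real) \<Rightarrow> bool" where
  "psd_weight n k w \<longleftrightarrow> (\<forall>(u :: nat \<Rightarrow> nat set) (c :: nat \<Rightarrow> real). (\<forall>i<k. u i \<subseteq> {..<n}) \<longrightarrow>
     0 \<le> (\<Sum>i<k. \<Sum>j<k. c i * c j * w (sym_diff (u i) (u j))))"

text \<open>A product of two monomials has the symmetric difference of their classes as its class,
  so expanding the square gives exactly the quadratic form of \<open>psd_weight\<close> in the
  numbers \<open>c j\<close>.\<close>

lemma weighted_eval_k_nomial_square:
  assumes "psd_weight n k w" "k_nomial n k q"
  shows "0 \<le> weighted_eval n w z (q\<^sup>2)"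
proof -
  obtain \<alpha> m where m: "\<And>j. j < k \<Longrightarrow> monomial_in n (m j)"
    and q: "q = (\<Sum>j<k. Poly_Mapping.single (m j) (\<alpha> j))"
    using assms(2) by (auto simp: k_nomial_def)
  define c where "c j = \<alpha> j * eval_monomial n z (m j)" for j
  have "weighted_eval n w z (q\<^sup>2) =
      (\<Sum>i<k. \<Sum>j<k. c i * c j * w (sym_diff (parity_class (m i)) (parity_class (m j))))"
    by (simp add: q power2_eq_square sum_product mult_single weighted_eval_sum weighted_eval_single
        parity_class_add eval_monomial_add c_def mult_ac)
  also have "\<dots> \<ge> 0"
    using assms(1)[unfolded psd_weight_def, rule_format, of "\<lambda>j. parity_class (m j)" c]
      m parity_class_subset by simp
  finally show ?thesis .
qed

lemma weighted_form_nonneg: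
  assumes "sum_of_squares_of_k_nomials n k (G n ^ r * quad_poly n a)" "psd_weight n k w"
  shows "0 \<le> (\<Sum>i<n. \<Sum>j<n. a i j * w (if i = j then {} else {i, j}) * z i * z j)"
proof (cases "\<forall>i<n. z i = 0")
  case False
  then obtain i where i: "i < n" "z i \<noteq> 0" by blast
  \<comment> \<open>At a nonzero point \<open>G n\<close> is positive, so its power can be
    cancelled; this disposes of \<open>r\<close>.\<close>
  have "0 < (\<Sum>i<n. (z i)\<^sup>2)"
    by (rule sum_pos2[of _ i]) (use i in auto)
  then have "0 < (\<Sum>i<n. (z i)\<^sup>2) ^ r" by simp
  moreover have "0 \<le> weighted_eval n w z (G n ^ r * quad_poly n a)"
    using assms weighted_eval_k_nomial_square
    by (auto simp: sum_of_squares_of_k_nomials_def weighted_eval_sum intro!: sum_nonneg)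
  ultimately show ?thesis
    by (simp add: weighted_eval_G_power_mult weighted_eval_quad_poly zero_le_mult_iff not_le[symmetric])
qed simp

section \<open>Quadratic forms as symmetric matrices\<close>

lemma quadratic_form_keys:
  assumes "quadratic_form n p" "m \<in> Poly_Mapping.keys p"
  obtains i j where "i < n" "j < n" "m = quad_monomial i j"
proof -
  have sub: "Poly_Mapping.keys m \<subseteq> {..<n}"
    and deg: "(\<Sum>i\<in>Poly_Mapping.keys m. Poly_Mapping.lookup m i) = 2"
    using assms by (auto simp: quadratic_form_def monomial_in_def monomial_degree_def)
  from deg have "Poly_Mapping.keys m \<noteq> {}" by auto
  then obtain i where i: "i \<in> Poly_Mapping.keys m" by blast
  have le: "Poly_Mapping.lookup m i \<ge> 1" using i by (auto simp: in_keys_iff)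
  have deg': "Poly_Mapping.lookup m i + (\<Sum>j\<in>Poly_Mapping.keys m - {i}. Poly_Mapping.lookup m j) = 2"
    using deg i by (simp add: sum.remove[of _ i])
  consider "Poly_Mapping.lookup m i = 2" | "Poly_Mapping.lookup m i = 1"
    using le deg' by linarith
  then show thesis
  proof cases
    case 1
    then have "(\<Sum>j\<in>Poly_Mapping.keys m - {i}. Poly_Mapping.lookup m j) = 0" using deg' by simp
    then have "\<And>j. j \<noteq> i \<Longrightarrow> Poly_Mapping.lookup m j = 0"
      by (auto simp: in_keys_iff)
    then have "m = quad_monomial i i"
      using 1 by (intro poly_mapping_eqI) (auto simp: quad_monomial_def lookup_add lookup_single when_def)
    with that i sub show thesis by blast
  next
    case 2
    then have s: "(\<Sum>j\<in>Poly_Mapping.keys m - {i}. Poly_Mapping.lookup m j) = 1" using deg' by simp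
    then obtain j where j: "j \<in> Poly_Mapping.keys m - {i}" "Poly_Mapping.lookup m j = 1"
      "\<forall>k\<in>Poly_Mapping.keys m - {i}. k \<noteq> j \<longrightarrow> Poly_Mapping.lookup m k = 0"
      using sum_eq_1_iff[of "Poly_Mapping.keys m - {i}" "Poly_Mapping.lookup m"] by (metis (no_types, lifting) finite_Diff finite_keys)
    then have "m = quad_monomial i j"
      using 2 by (intro poly_mapping_eqI) (auto simp: quad_monomial_def lookup_add lookup_single when_def in_keys_iff)
    with that i j sub show thesis by blast
  qed
qed

text \<open>Halving off the diagonal compensates for \<open>quad_poly\<close> counting each mixed
  monomial twice.\<close>

definition form_matrix :: "rpoly \<Rightarrow> nat \<Rightarrow> nat \<Rightarrow> real" where
  "form_matrix p i j = Poly_Mapping.lookup p (quad_monomial i j) / (if i = j then 1 else 2)"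

lemma form_matrix_commute: "form_matrix p i j = form_matrix p j i"
  by (auto simp: form_matrix_def quad_monomial_commute)

lemma lookup_quad_poly:
  assumes "k < n" "l < n"
  shows "Poly_Mapping.lookup (quad_poly n a) (quad_monomial k l) = (if k = l then a k k else a k l + a l k)"
proof -
  have "Poly_Mapping.lookup (quad_poly n a) (quad_monomial k l) =
     (\<Sum>i<n. \<Sum>j<n. if (i = k \<and> j = l) \<or> (i = l \<and> j = k) then a i j else 0)"
    by (simp add: quad_poly_def lookup_sum lookup_single when_def quad_monomial_eq_iff)
  also have "\<dots> = (\<Sum>x\<in>{..<n} \<times> {..<n}. if x \<in> {(k, l), (l, k)} then a (fst x) (snd x) else 0)"
    unfolding sum.cartesian_product by (rule sum.cong) (auto simp del: if_cong split: if_splits)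
  \<comment> \<open>For \<open>k = l\<close> this set has a single element, so the diagonal entry is
    counted once.\<close>
  also have "\<dots> = (\<Sum>x\<in>{(k, l), (l, k)}. a (fst x) (snd x))"
    by (rule sum.mono_neutral_cong_right) (use assms in auto)
  also have "\<dots> = (if k = l then a k k else a k l + a l k)"
    by auto
  finally show ?thesis .
qed

lemma quadratic_form_eq_quad_poly:
  assumes "quadratic_form n p"
  shows "p = quad_poly n (form_matrix p)"
proof (rule poly_mapping_eqI)
  fix m
  show "Poly_Mapping.lookup p m = Poly_Mapping.lookup (quad_poly n (form_matrix p)) m"
  proof (cases "\<exists>k<n. \<exists>l<n. m = quad_monomial k l")
    case True
    then show ?thesis
      by (auto simp: lookup_quad_poly) (auto simp: form_matrix_def quad_monomial_commute)
  next
    case False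
    then have "Poly_Mapping.lookup p m = 0"
      using quadratic_form_keys[OF assms, of m] by (auto simp: in_keys_iff)
    moreover have "Poly_Mapping.lookup (quad_poly n (form_matrix p)) m = 0"
      using False unfolding quad_poly_def lookup_sum
      by (intro sum.neutral ballI) (auto simp: lookup_single when_def)
    ultimately show ?thesis by simp
  qed
qed

section \<open>Permutations of the variables\<close>

lemma rename_quad_monomial:
  "rename_monomial \<sigma> (quad_monomial i j) = quad_monomial (\<sigma> i) (\<sigma> j)"
proof (cases "i = j")
  case True
  then have "quad_monomial i j = Poly_Mapping.single i 2"
    by (metis one_add_one quad_monomial_def single_add)
  then show ?thesis using True
    by (simp add: rename_monomial_def) (metis one_add_one quad_monomial_def single_add)
next
  case False
  have k: "Poly_Mapping.keys (quad_monomial i j) = {i, j}"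
    by (auto simp: quad_monomial_def in_keys_iff lookup_add lookup_single when_def split: if_splits)
  show ?thesis using False
    by (simp add: rename_monomial_def k) (simp add: quad_monomial_def lookup_add lookup_single)
qed

lemma lookup_rename_quad_monomial:
  assumes "quadratic_form n p" "inj \<sigma>"
  shows "Poly_Mapping.lookup (rename_vars \<sigma> p) (quad_monomial (\<sigma> i) (\<sigma> j)) =
         Poly_Mapping.lookup p (quad_monomial i j)"
proof -
  have "Poly_Mapping.lookup (rename_vars \<sigma> p) (quad_monomial (\<sigma> i) (\<sigma> j)) =
    (\<Sum>m\<in>Poly_Mapping.keys p. if m = quad_monomial i j then Poly_Mapping.lookup p (quad_monomial i j) else 0)"
    unfolding rename_vars_def lookup_sum
  proof (intro sum.cong refl)
    fix m assume "m \<in> Poly_Mapping.keys p"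
    then obtain k l where m: "m = quad_monomial k l"
      by (rule quadratic_form_keys[OF assms(1)])
    show "Poly_Mapping.lookup (Poly_Mapping.single (rename_monomial \<sigma> m) (Poly_Mapping.lookup p m))
        (quad_monomial (\<sigma> i) (\<sigma> j)) =
        (if m = quad_monomial i j then Poly_Mapping.lookup p (quad_monomial i j) else 0)"
      unfolding m rename_quad_monomial lookup_single when_def quad_monomial_eq_iff inj_eq[OF assms(2)]
      using quad_monomial_commute[of i j] by auto
  qed
  also have "\<dots> = Poly_Mapping.lookup p (quad_monomial i j)"
    by (auto simp: in_keys_iff)
  finally show ?thesis .
qed

lemma symmetric_form_matrix_permute:
  assumes "quadratic_form n p" "symmetric_poly n p" "\<sigma> permutes {..<n}"
  shows "form_matrix p (\<sigma> i) (\<sigma> j) = form_matrix p i j"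
proof -
  have inj: "inj \<sigma>" using assms(3) by (rule permutes_inj)
  show ?thesis
    using lookup_rename_quad_monomial[OF assms(1) inj, of i j] assms(2,3) inj
    by (simp add: symmetric_poly_def form_matrix_def inj_eq)
qed

text \<open>Transpositions suffice: they carry any diagonal entry to any other, and they change one
  index of an off-diagonal entry at a time. Such moves and the symmetry of the matrix connect all
  off-diagonal positions.\<close>

lemma symmetric_form_matrix_constant:
  assumes "quadratic_form n p" "symmetric_poly n p"
  obtains \<alpha> \<beta> where "\<And>i j. i < n \<Longrightarrow> j < n \<Longrightarrow> form_matrix p i j = (if i = j then \<alpha> else \<beta>)"
proof -
  let ?a = "form_matrix p"
  have tr: "?a (Transposition.transpose k l i) (Transposition.transpose k l j) = ?a i j"
    if "k < n" "l < n" for k l i j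
    by (rule symmetric_form_matrix_permute[OF assms permutes_swap_id]) (use that in auto)
  have diag: "?a i i = ?a 0 0" if "i < n" for i
    using tr[of 0 i 0 0] that by (cases "n = 0") auto
  have first: "?a i j = ?a k j" if "i < n" "k < n" "i \<noteq> j" "k \<noteq> j" for i j k
    using tr[of i k i j] that by (simp add: Transposition.transpose_def)
  have off: "?a i j = ?a k l" if "i < n" "j < n" "k < n" "l < n" "i \<noteq> j" "k \<noteq> l" for i j k l
  proof (cases "k = j")
    \<comment> \<open>Moving the first index to \<open>k\<close> would hit the diagonal, so it moves
      to \<open>l\<close> and the two indices are swapped.\<close>
    case True
    then have "?a i j = ?a l j" using that first[of i l j] by (cases "i = l") auto
    then show ?thesis using True form_matrix_commute[of p l j] by simp
  next
    case False
    then have "?a i j = ?a k j" using that first[of i k j] by (cases "i = k") auto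
    also have "\<dots> = ?a j k" by (rule form_matrix_commute)
    also have "\<dots> = ?a l k" using that False first[of j l k] by (cases "j = l") auto
    also have "\<dots> = ?a k l" by (rule form_matrix_commute)
    finally show ?thesis .
  qed
  show thesis
  proof (rule that)
    fix i j assume "i < n" "j < n"
    then show "?a i j = (if i = j then ?a 0 0 else ?a 0 1)"
      using diag[of i] off[of i j 0 1] by (cases "i = j") auto
  qed
qed

section \<open>Sums of squares of binomials\<close>

lemma sos_k_nomial_zero: "sum_of_squares_of_k_nomials n k 0"
  unfolding sum_of_squares_of_k_nomials_def by (rule exI[of _ 0]) simp

lemma sos_k_nomial_square: "k_nomial n k q \<Longrightarrow> sum_of_squares_of_k_nomials n k (q\<^sup>2)"
  unfolding sum_of_squares_of_k_nomials_def
  by (rule exI[of _ 1], rule exI[of _ "\<lambda>_. q"]) simp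

lemma sos_k_nomial_add:
  assumes "sum_of_squares_of_k_nomials n k p" "sum_of_squares_of_k_nomials n k q"
  shows "sum_of_squares_of_k_nomials n k (p + q)"
proof -
  obtain M :: nat and f where f: "\<forall>j<M. k_nomial n k (f j)" "p = (\<Sum>j<M. f j ^ 2)"
    using assms(1) unfolding sum_of_squares_of_k_nomials_def by blast
  obtain N :: nat and g where g: "\<forall>j<N. k_nomial n k (g j)" "q = (\<Sum>j<N. g j ^ 2)"
    using assms(2) unfolding sum_of_squares_of_k_nomials_def by blast
  let ?h = "\<lambda>j. if j < M then f j else g (j - M)"
  have split: "(\<Sum>j<M + N. ?h j ^ 2) = (\<Sum>j<M. f j ^ 2) + (\<Sum>j<N. g j ^ 2)"
    by (induction N) (simp_all add: add.assoc[symmetric])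
  show ?thesis
    unfolding sum_of_squares_of_k_nomials_def
    by (rule exI[of _ "M + N"], rule exI[of _ ?h]) (use f g split in auto)
qed

lemma sos_k_nomial_sum:
  "(\<And>x. x \<in> A \<Longrightarrow> sum_of_squares_of_k_nomials n k (f x)) \<Longrightarrow>
   sum_of_squares_of_k_nomials n k (sum f A)"
  by (induction A rule: infinite_finite_induct)
     (auto simp: sos_k_nomial_zero intro: sos_k_nomial_add)

lemma k_nomial_linear_form:
  assumes "S \<subseteq> {..<n}" "card S \<le> k"
  shows "k_nomial n k (\<Sum>i\<in>S. Poly_Mapping.single (Poly_Mapping.single i 1) (v i))"
proof -
  have "finite S" using assms(1) finite_subset by blast
  then obtain f where f: "bij_betw f {0..<card S} S"
    using ex_bij_betw_nat_finite by blast
  then have f: "bij_betw f {..<card S} S" by (simp add: lessThan_atLeast0)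
  \<comment> \<open>Missing terms are padded with the constant monomial and coefficient
    zero.\<close>
  let ?m = "\<lambda>j. if j < card S then Poly_Mapping.single (f j) 1 else (0 :: monomial)"
  let ?\<alpha> = "\<lambda>j. if j < card S then v (f j) else 0"
  have "(\<Sum>j<k. Poly_Mapping.single (?m j) (?\<alpha> j)) = (\<Sum>j<card S. Poly_Mapping.single (?m j) (?\<alpha> j))"
    using assms(2) by (intro sum.mono_neutral_right) auto
  also have "\<dots> = (\<Sum>j<card S. Poly_Mapping.single (Poly_Mapping.single (f j) 1) (v (f j)))"
    by (intro sum.cong) auto
  also have "\<dots> = (\<Sum>i\<in>S. Poly_Mapping.single (Poly_Mapping.single i 1) (v i))"
    by (rule sum.reindex_bij_betw[OF f])
  finally have eq: "(\<Sum>i\<in>S. Poly_Mapping.single (Poly_Mapping.single i 1) (v i)) =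
    (\<Sum>j<k. Poly_Mapping.single (?m j) (?\<alpha> j))" by simp
  have "f j < n" if "j < card S" for j
    using f that assms(1) by (auto simp: bij_betw_def)
  then have "\<forall>j<k. monomial_in n (?m j)"
    by (auto simp: monomial_in_single) (simp add: monomial_in_def)
  with eq show ?thesis
    unfolding k_nomial_def by (intro exI[of _ ?\<alpha>] exI[of _ ?m] conjI)
qed

lemma sos_linear_form_square:
  assumes "S \<subseteq> {..<n}" "card S \<le> k"
  shows "sum_of_squares_of_k_nomials n k
    (\<Sum>i\<in>S. \<Sum>j\<in>S. Poly_Mapping.single (quad_monomial i j) (v i * v j))"
  using sos_k_nomial_square[OF k_nomial_linear_form[OF assms, of v]]
  by (simp add: power2_eq_square sum_product mult_single quad_monomial_def)

lemma sos_single_square: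
  assumes "i < n" "1 \<le> k" "0 \<le> c"
  shows "sum_of_squares_of_k_nomials n k (Poly_Mapping.single (quad_monomial i i) c)"
  using sos_linear_form_square[of "{i}" n k "\<lambda>_. sqrt c"] assms by simp

lemma sos_binomial_square:
  assumes "i < n" "j < n" "i \<noteq> j" "2 \<le> k"
  shows "sum_of_squares_of_k_nomials n k (Poly_Mapping.single (quad_monomial i i) (s\<^sup>2)
    + Poly_Mapping.single (quad_monomial j j) (t\<^sup>2)
    + Poly_Mapping.single (quad_monomial i j) (2 * s * t))"
proof -
  have "sum_of_squares_of_k_nomials n k
    (\<Sum>l\<in>{i, j}. \<Sum>m\<in>{i, j}. Poly_Mapping.single (quad_monomial l m)
      ((if l = i then s else t) * (if m = i then s else t)))"
    by (rule sos_linear_form_square) (use assms in auto)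
  also have "(\<Sum>l\<in>{i, j}. \<Sum>m\<in>{i, j}. Poly_Mapping.single (quad_monomial l m)
      ((if l = i then s else t) * (if m = i then s else t))) =
    Poly_Mapping.single (quad_monomial i i) (s\<^sup>2) + Poly_Mapping.single (quad_monomial j j) (t\<^sup>2)
    + (Poly_Mapping.single (quad_monomial i j) (s * t) + Poly_Mapping.single (quad_monomial i j) (s * t))"
    using assms(3) by (simp add: quad_monomial_commute[of j i] power2_eq_square mult.commute[of t s] add_ac)
  also have "Poly_Mapping.single (quad_monomial i j) (s * t) + Poly_Mapping.single (quad_monomial i j) (s * t)
    = Poly_Mapping.single (quad_monomial i j) (2 * s * t)"
    by (simp add: single_add[symmetric] mult.assoc)
  finally show ?thesis .
qed

lemma sum_single: "(\<Sum>x\<in>A. Poly_Mapping.single m (f x)) = Poly_Mapping.single m (\<Sum>x\<in>A. f x)"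
  by (induction A rule: infinite_finite_induct) (simp_all add: single_add)

lemma quad_poly_cong:
  "(\<And>i j. i < n \<Longrightarrow> j < n \<Longrightarrow> a i j = b i j) \<Longrightarrow> quad_poly n a = quad_poly n b"
  by (simp add: quad_poly_def)

lemma quad_poly_add: "quad_poly n (\<lambda>i j. a i j + b i j) = quad_poly n a + quad_poly n b"
  by (simp add: quad_poly_def single_add sum.distrib)

lemma quad_poly_diagonal:
  "quad_poly n (\<lambda>i j. if i = j then h i else 0) = (\<Sum>i<n. Poly_Mapping.single (quad_monomial i i) (h i))"
proof -
  have "(\<Sum>j<n. Poly_Mapping.single (quad_monomial i j) (if i = j then h i else 0)) =
    Poly_Mapping.single (quad_monomial i i) (h i)" if "i < n" for i
  proof -
    have "(\<Sum>j<n. Poly_Mapping.single (quad_monomial i j) (if i = j then h i else 0)) =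
      (\<Sum>j<n. if i = j then Poly_Mapping.single (quad_monomial i i) (h i) else 0)"
      by (rule sum.cong) auto
    then show ?thesis using that by simp
  qed
  then show ?thesis by (simp add: quad_poly_def)
qed

lemma sos_quad_poly_diagonal:
  assumes "1 \<le> k" "\<And>i. i < n \<Longrightarrow> 0 \<le> h i"
  shows "sum_of_squares_of_k_nomials n k (quad_poly n (\<lambda>i j. if i = j then h i else 0))"
  unfolding quad_poly_diagonal by (rule sos_k_nomial_sum) (use assms in \<open>auto intro: sos_single_square\<close>)

text \<open>This is scaled diagonal dominance. Each ordered pair of distinct indices contributes one
  binomial square with cross term \<open>a i j\<close>, and \<open>dom\<close> says that the
  diagonal can pay for the square terms.\<close>

lemma sos_quad_poly_diagonally_dominant:
  assumes k: "2 \<le> k" and d: "\<And>i. i < n \<Longrightarrow> 0 < d i"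
    and dom: "\<And>i. i < n \<Longrightarrow> (\<Sum>j<n. if j = i then 0 else \<bar>a i j\<bar> * d j) \<le> a i i * d i"
    and sym: "\<And>i j. i < n \<Longrightarrow> j < n \<Longrightarrow> a i j = a j i"
  shows "sum_of_squares_of_k_nomials n k (quad_poly n a)"
proof -
  \<comment> \<open>The cost of a pair is split in proportion to \<open>d\<close>: for
    \<open>i \<noteq> j\<close>, symmetry gives \<open>h i j * h j i = (a i j / 2)^2\<close>, which
    makes \<open>?T i j\<close> a perfect square. The diagonal left over is
    \<open>e\<close>.\<close>
  define h where "h i j = (if i = j then 0 else \<bar>a i j\<bar> * d j / (2 * d i))" for i j
  let ?S = "\<lambda>i j. Poly_Mapping.single (quad_monomial i j) :: real \<Rightarrow> rpoly"
  let ?T = "\<lambda>i j. ?S i i (h i j) + ?S j j (h j i) + ?S i j (if i = j then 0 else a i j)"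
  define e where "e i = a i i - (\<Sum>j<n. 2 * h i j)" for i
  have T: "sum_of_squares_of_k_nomials n k (?T i j)" if "i < n" "j < n" for i j
  proof (cases "i = j")
    case True
    then show ?thesis by (simp add: h_def sos_k_nomial_zero)
  next
    case False
    define s where "s = sqrt (\<bar>a i j\<bar> * d j / (2 * d i))"
    define t where "t = sgn (a i j) * sqrt (\<bar>a i j\<bar> * d i / (2 * d j))"
    have di: "0 < d i" "0 < d j" using d that by auto
    have 1: "s\<^sup>2 = h i j" using di False by (simp add: s_def h_def)
    have 2: "t\<^sup>2 = h j i"
      using di False sym[OF that] by (auto simp: t_def h_def power_mult_distrib sgn_if)
    have "s * sqrt (\<bar>a i j\<bar> * d i / (2 * d j)) = sqrt ((\<bar>a i j\<bar> / 2)\<^sup>2)"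
      unfolding s_def real_sqrt_mult[symmetric] using di
      by (intro arg_cong[where f = sqrt]) (simp add: field_simps power2_eq_square)
    then have "s * sqrt (\<bar>a i j\<bar> * d i / (2 * d j)) = \<bar>a i j\<bar> / 2" by simp
    then have "2 * s * t = sgn (a i j) * \<bar>a i j\<bar>" by (simp add: t_def)
    then have 3: "2 * s * t = a i j" by (simp add: sgn_mult_abs)
    show ?thesis
      using sos_binomial_square[OF that False k, of s t] False unfolding 1 2 3 by simp
  qed
  have e: "0 \<le> e i" if i: "i < n" for i
  proof -
    have "(\<Sum>j<n. 2 * h i j) = (\<Sum>j<n. if j = i then 0 else \<bar>a i j\<bar> * d j) / d i"
      unfolding sum_divide_distrib using d[OF i] by (intro sum.cong) (auto simp: h_def)
    also have "\<dots> \<le> a i i" using dom[OF i] d[OF i] by (simp add: pos_divide_le_eq)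
    finally show ?thesis by (simp add: e_def)
  qed
  \<comment> \<open>The square of a variable is paid for in the pair \<open>(i, j)\<close> and again
    in \<open>(j, i)\<close>; hence the factor 2 in \<open>e\<close>.\<close>
  have "(\<Sum>i<n. \<Sum>j<n. ?S j j (h j i)) = (\<Sum>i<n. \<Sum>j<n. ?S i i (h i j))"
    by (rule sum.swap)
  moreover have "?S i i (\<Sum>j<n. 2 * h i j) = (\<Sum>j<n. ?S i i (h i j)) + (\<Sum>j<n. ?S i i (h i j))" for i
    unfolding mult_2 sum.distrib single_add sum_single ..
  ultimately have "(\<Sum>i<n. \<Sum>j<n. ?T i j) =
      (\<Sum>i<n. ?S i i (\<Sum>j<n. 2 * h i j)) + quad_poly n (\<lambda>i j. if i = j then 0 else a i j)"
    unfolding quad_poly_def sum.distrib by (simp only: sum.distrib)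
  moreover have "quad_poly n a = (\<Sum>i<n. ?S i i (\<Sum>j<n. 2 * h i j))
      + quad_poly n (\<lambda>i j. if i = j then 0 else a i j) + quad_poly n (\<lambda>i j. if i = j then e i else 0)"
    unfolding quad_poly_diagonal[symmetric] quad_poly_add[symmetric]
    by (rule quad_poly_cong) (simp add: e_def)
  ultimately have "quad_poly n a =
      (\<Sum>i<n. \<Sum>j<n. ?T i j) + quad_poly n (\<lambda>i j. if i = j then e i else 0)" by simp
  moreover have "sum_of_squares_of_k_nomials n k (\<Sum>i<n. \<Sum>j<n. ?T i j)"
    by (intro sos_k_nomial_sum T) auto
  ultimately show ?thesis
    using sos_quad_poly_diagonal[of k n e] e k by (auto intro: sos_k_nomial_add)
qed

section \<open>Positive semidefinite Z-matrices\<close>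

lemma form_Suc:
  fixes M :: "nat \<Rightarrow> nat \<Rightarrow> real"
  assumes "\<And>i j. i < Suc n \<Longrightarrow> j < Suc n \<Longrightarrow> M i j = M j i"
  shows "(\<Sum>i<Suc n. \<Sum>j<Suc n. M i j * z i * z j) =
    (\<Sum>i<n. \<Sum>j<n. M i j * z i * z j) + 2 * z n * (\<Sum>j<n. M n j * z j) + M n n * (z n)\<^sup>2"
proof -
  have "(\<Sum>i<n. M i n * z i * z n) = z n * (\<Sum>j<n. M n j * z j)"
    unfolding sum_distrib_left using assms by (intro sum.cong) (auto simp: less_Suc_eq)
  moreover have "(\<Sum>j<n. M n j * z n * z j) = z n * (\<Sum>j<n. M n j * z j)"
    unfolding sum_distrib_left by (intro sum.cong) auto
  ultimately show ?thesis
    by (simp add: sum.distrib power2_eq_square)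
qed

text \<open>Induction by Schur complement: eliminating the last index preserves semidefiniteness and
  the nonpositive off-diagonal signs. The vector found for the complement is extended by a
  coordinate that balances the last row.\<close>

lemma psd_Z_matrix_positive_vector:
  fixes M :: "nat \<Rightarrow> nat \<Rightarrow> real"
  assumes "\<And>i j. i < n \<Longrightarrow> j < n \<Longrightarrow> M i j = M j i"
    and "\<And>i j. i < n \<Longrightarrow> j < n \<Longrightarrow> i \<noteq> j \<Longrightarrow> M i j \<le> 0"
    and "\<And>z. 0 \<le> (\<Sum>i<n. \<Sum>j<n. M i j * z i * z j)"
  shows "\<exists>d. (\<forall>i<n. 0 < d i) \<and> (\<forall>i<n. 0 \<le> (\<Sum>j<n. M i j * d j))"
  using assms
proof (induction n arbitrary: M)
  case (Suc n)
  note sym = Suc.prems(1) and Z = Suc.prems(2) and psd = Suc.prems(3)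
  \<comment> \<open>If the pivot is zero, division by zero makes \<open>S\<close> the plain block of
    \<open>M\<close>; by the fact \<open>zero\<close> below, the last row then vanishes.\<close>
  define S where "S i j = M i j - M n i * M n j / M n n" for i j
  let ?B = "\<lambda>z. \<Sum>j<n. M n j * z j"
  have ext: "0 \<le> (\<Sum>i<n. \<Sum>j<n. M i j * z i * z j) + 2 * s * ?B z + M n n * s\<^sup>2" for z s
  proof -
    have "(\<Sum>i<n. \<Sum>j<n. M i j * (z(n := s)) i * (z(n := s)) j) = (\<Sum>i<n. \<Sum>j<n. M i j * z i * z j)"
      by (intro sum.cong) auto
    moreover have "?B (z(n := s)) = ?B z" by (intro sum.cong) auto
    ultimately show ?thesis
      using psd[of "z(n := s)"] form_Suc[of n M "z(n := s)", OF sym] by (simp only: fun_upd_same)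
  qed
  have nn: "0 \<le> M n n" using ext[of "\<lambda>_. 0" 1] by simp
  have zero: "M n j = 0" if "M n n = 0" "j < n" for j
  proof (rule ccontr)
    assume nz: "M n j \<noteq> 0"
    define z where "z = (\<lambda>i. if i = j then 1 else 0 :: real)"
    have B: "?B z = M n j" using that by (simp add: z_def if_distrib[of "(*) _"] cong: if_cong)
    define c where "c = (\<Sum>i<n. \<Sum>j<n. M i j * z i * z j)"
    \<comment> \<open>This last coordinate brings the form to \<open>-1\<close>: with a zero pivot
      it is affine in that coordinate.\<close>
    have "0 \<le> c + 2 * (- (c + 1) / (2 * M n j)) * M n j"
      using ext[of z "- (c + 1) / (2 * M n j)"] that(1) by (simp add: B c_def)
    then show False using nz by (simp add: field_simps)
  qed
  have S_form: "(\<Sum>i<n. \<Sum>j<n. S i j * z i * z j) =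
    (\<Sum>i<n. \<Sum>j<n. M i j * z i * z j) - (?B z)\<^sup>2 / M n n" for z
    unfolding power2_eq_square sum_product sum_divide_distrib sum_subtractf[symmetric]
    by (intro sum.cong refl) (simp add: S_def algebra_simps)
  have S_psd: "0 \<le> (\<Sum>i<n. \<Sum>j<n. S i j * z i * z j)" for z
  proof (cases "M n n = 0")
    case True
    then show ?thesis using ext[of z 0] by (simp add: S_form)
  next
    case False
    \<comment> \<open>The last coordinate \<open>- ?B z / M n n\<close> minimises the form.\<close>
    then have "2 * (- ?B z / M n n) * ?B z + M n n * (- ?B z / M n n)\<^sup>2 = - (?B z)\<^sup>2 / M n n"
      by (simp add: field_simps power2_eq_square)
    then show ?thesis using ext[of z "- ?B z / M n n"] by (simp add: S_form)
  qed
  have S_Z: "S i j \<le> 0" if "i < n" "j < n" "i \<noteq> j" for i j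
  proof -
    have "0 \<le> M n i * M n j / M n n"
      using Z[of n i] Z[of n j] that nn by (simp add: mult_nonpos_nonpos)
    then show ?thesis using Z[of i j] that by (simp add: S_def)
  qed
  obtain d where d: "\<And>i. i < n \<Longrightarrow> 0 < d i" "\<And>i. i < n \<Longrightarrow> 0 \<le> (\<Sum>j<n. S i j * d j)"
    using Suc.IH[of S] S_Z S_psd sym by (auto simp: S_def)
  have S_row: "(\<Sum>j<n. S i j * d j) = (\<Sum>j<n. M i j * d j) - M n i * ?B d / M n n" for i
    unfolding sum_distrib_left sum_divide_distrib sum_subtractf[symmetric]
    by (intro sum.cong refl) (simp add: S_def algebra_simps)
  \<comment> \<open>If \<open>?B d = 0\<close>, its nonpositive terms all vanish, hence so does the
    last row off the diagonal, and any positive \<open>t\<close> will do. Otherwise \<open>t\<close>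
    makes the last row sum to zero, and the other rows become rows of \<open>S\<close>.\<close>
  define t where "t = (if ?B d = 0 then 1 else - ?B d / M n n)"
  have term_le: "M n j * d j \<le> 0" if "j < n" for j
    using Z[of n j] d(1)[OF that] that by (simp add: mult_nonpos_nonneg)
  have B_le: "?B d \<le> 0" by (intro sum_nonpos) (use term_le in auto)
  have B_zero: "M n j = 0" if "?B d = 0" "j < n" for j
  proof -
    have "(\<Sum>j<n. - (M n j * d j)) = 0" using that(1) by (simp add: sum_negf)
    then have "- (M n j * d j) = 0"
      using term_le that(2) by (subst (asm) sum_nonneg_eq_0_iff) auto
    then show ?thesis using d(1)[OF that(2)] by simp
  qed
  have B_ne: "0 < M n n" if "?B d \<noteq> 0"
    using zero that nn by (cases "M n n = 0") auto
  have t: "0 < t"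
    using B_le B_ne by (auto simp: t_def intro!: divide_neg_pos)
  let ?d = "d(n := t)"
  have row: "(\<Sum>j<Suc n. M i j * ?d j) = (\<Sum>j<n. M i j * d j) + M i n * t" for i
    by simp
  have "0 \<le> (\<Sum>j<Suc n. M i j * ?d j)" if i: "i < Suc n" for i
  proof (cases "i = n")
    case True
    then show ?thesis unfolding row using nn B_ne by (auto simp: t_def)
  next
    case False
    then have i: "i < n" using i by simp
    have "M i n * t = - (M n i * ?B d / M n n)"
      using sym[of i n] i B_zero[OF _ i] by (auto simp: t_def)
    then show ?thesis unfolding row using d(2)[OF i] by (simp add: S_row)
  qed
  moreover have "0 < ?d i" if "i < Suc n" for i
    using that t d(1)[of i] by auto
  ultimately show ?case by blast
qed simp

text \<open>With this weight the functional is plain evaluation, which yields positive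
  semidefiniteness of the form.\<close>

lemma psd_weight_one: "psd_weight n k (\<lambda>_. 1)"
  by (auto simp: psd_weight_def sum_product[symmetric])

lemma psd_weight_2:
  assumes "w {} = 1" "\<And>u. \<bar>w u\<bar> \<le> 1"
  shows "psd_weight n 2 w"
  unfolding psd_weight_def
proof (intro allI impI)
  fix u :: "nat \<Rightarrow> nat set" and c :: "nat \<Rightarrow> real"
  let ?w = "w (sym_diff (u 0) (u 1))"
  have "(\<Sum>i<2. \<Sum>j<2. c i * c j * w (sym_diff (u i) (u j))) = (c 0 + ?w * c 1)\<^sup>2 + (1 - ?w\<^sup>2) * (c 1)\<^sup>2"
    by (simp add: numeral_2_eq_2 assms(1) Un_commute power2_eq_square algebra_simps)
  moreover have "?w\<^sup>2 \<le> 1" using assms(2)[of "sym_diff (u 0) (u 1)"] by (simp add: abs_square_le_1)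
  ultimately show "0 \<le> (\<Sum>i<2. \<Sum>j<2. c i * c j * w (sym_diff (u i) (u j)))" by simp
qed

lemma sos_binomials_of_G_power_mult:
  assumes sos: "sum_of_squares_of_k_nomials n 2 (G n ^ r * quad_poly n a)"
    and sym: "\<And>i j. i < n \<Longrightarrow> j < n \<Longrightarrow> a i j = a j i"
  shows "sum_of_squares_of_k_nomials n 2 (quad_poly n a)"
proof -
  \<comment> \<open>\<open>Min\<close> and \<open>Max\<close> recover the two indices from the set
    \<open>{i, j}\<close>; on other nonempty sets what counts is the bound by 1.\<close>
  define w where "w u = (if u = {} then 1 else - sgn (a (Min u) (Max u)))" for u
  \<comment> \<open>The comparison matrix of \<open>a\<close> will be a positive semidefinite
    Z-matrix, and its positive vector is the scaling for diagonal dominance.\<close>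
  define M where "M i j = (if i = j then a i i else - \<bar>a i j\<bar>)" for i j
  have "psd_weight n 2 w"
    by (rule psd_weight_2) (auto simp: w_def abs_sgn_eq)
  note nonneg = weighted_form_nonneg[OF sos this]
  have M: "a i j * w (if i = j then {} else {i, j}) = M i j" if "i < n" "j < n" for i j
    using sym[OF that] by (cases i j rule: linorder_cases) (auto simp: w_def M_def min_def max_def abs_sgn)
  have M_psd: "0 \<le> (\<Sum>i<n. \<Sum>j<n. M i j * z i * z j)" for z
    using nonneg[of z] M by simp
  have "M i j = M j i" "i \<noteq> j \<Longrightarrow> M i j \<le> 0" if "i < n" "j < n" for i j
    using sym[OF that] by (auto simp: M_def)
  then obtain d where d: "\<And>i. i < n \<Longrightarrow> 0 < d i" "\<And>i. i < n \<Longrightarrow> 0 \<le> (\<Sum>j<n. M i j * d j)"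
    using psd_Z_matrix_positive_vector[of n M] M_psd by blast
  show ?thesis
  proof (rule sos_quad_poly_diagonally_dominant[OF _ d(1) _ sym])
    fix i assume i: "i < n"
    have "(\<Sum>j<n. M i j * d j) = (\<Sum>j<n. (if j = i then a i i * d i else 0) - (if j = i then 0 else \<bar>a i j\<bar> * d j))"
      by (intro sum.cong) (auto simp: M_def)
    also have "\<dots> = a i i * d i - (\<Sum>j<n. if j = i then 0 else \<bar>a i j\<bar> * d j)"
      using i by (simp add: sum_subtractf)
    finally show "(\<Sum>j<n. if j = i then 0 else \<bar>a i j\<bar> * d j) \<le> a i i * d i"
      using d(2)[OF i] by simp
  qed auto
qed

section \<open>Symmetric quadratic forms\<close>

lemma card_subsets_containing:
  assumes "X \<subseteq> A" "finite A" "card X \<le> k"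
  shows "card {S. S \<subseteq> A \<and> card S = k \<and> X \<subseteq> S} = (card A - card X) choose (k - card X)"
proof -
  have fX: "finite X" using assms finite_subset by blast
  have "bij_betw (\<lambda>T. T \<union> X) {T. T \<subseteq> A - X \<and> card T = k - card X} {S. S \<subseteq> A \<and> card S = k \<and> X \<subseteq> S}"
  proof (rule bij_betwI[where g = "\<lambda>S. S - X"])
    show "(\<lambda>T. T \<union> X) \<in> {T. T \<subseteq> A - X \<and> card T = k - card X} \<rightarrow> {S. S \<subseteq> A \<and> card S = k \<and> X \<subseteq> S}"
    proof
      fix T assume T: "T \<in> {T. T \<subseteq> A - X \<and> card T = k - card X}"
      then have "finite T" using assms(2) finite_subset by blast
      then have "card (T \<union> X) = card T + card X" using T fX by (intro card_Un_disjoint) auto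
      then show "T \<union> X \<in> {S. S \<subseteq> A \<and> card S = k \<and> X \<subseteq> S}" using T assms by auto
    qed
    show "(\<lambda>S. S - X) \<in> {S. S \<subseteq> A \<and> card S = k \<and> X \<subseteq> S} \<rightarrow> {T. T \<subseteq> A - X \<and> card T = k - card X}"
      using fX by (auto simp: card_Diff_subset)
  qed auto
  then have "card {S. S \<subseteq> A \<and> card S = k \<and> X \<subseteq> S} = card {T. T \<subseteq> A - X \<and> card T = k - card X}"
    by (rule bij_betw_same_card[symmetric])
  also have "\<dots> = card (A - X) choose (k - card X)"
    by (rule n_subsets) (use assms in auto)
  finally show ?thesis using assms fX by (simp add: card_Diff_subset)
qed

text \<open>Square \<open>sqrt c\<close> times the sum of the variables in \<open>S\<close>, and add
  over all \<open>k\<close>-subsets \<open>S\<close>: the entry at \<open>(i, j)\<close> counts the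
  subsets containing both.\<close>

lemma sos_quad_poly_subset_sums:
  assumes "0 \<le> c"
  shows "sum_of_squares_of_k_nomials n k (quad_poly n
    (\<lambda>i j. c * real (card {S. S \<subseteq> {..<n} \<and> card S = k \<and> {i, j} \<subseteq> S})))"
proof -
  let ?F = "{S. S \<subseteq> {..<n} \<and> card S = k}"
  have "sum_of_squares_of_k_nomials n k
      (\<Sum>S\<in>?F. \<Sum>i\<in>S. \<Sum>j\<in>S. Poly_Mapping.single (quad_monomial i j) (sqrt c * sqrt c))"
    by (rule sos_k_nomial_sum, rule sos_linear_form_square[where v = "\<lambda>_. sqrt c"]) auto
  also have "(\<Sum>S\<in>?F. \<Sum>i\<in>S. \<Sum>j\<in>S. Poly_Mapping.single (quad_monomial i j) (sqrt c * sqrt c)) =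
      (\<Sum>S\<in>?F. \<Sum>i<n. \<Sum>j<n. Poly_Mapping.single (quad_monomial i j) (if {i, j} \<subseteq> S then c else 0))"
  proof (rule sum.cong[OF refl])
    fix S assume S: "S \<in> ?F"
    have "(\<Sum>i\<in>S. \<Sum>j\<in>S. Poly_Mapping.single (quad_monomial i j) (sqrt c * sqrt c)) =
        (\<Sum>i\<in>S. \<Sum>j<n. Poly_Mapping.single (quad_monomial i j) (if {i, j} \<subseteq> S then c else 0))"
      by (intro sum.cong[OF refl] sum.mono_neutral_cong_left) (use S assms in auto)
    also have "\<dots> = (\<Sum>i<n. \<Sum>j<n. Poly_Mapping.single (quad_monomial i j) (if {i, j} \<subseteq> S then c else 0))"
      by (rule sum.mono_neutral_left) (use S in auto)
    finally show "(\<Sum>i\<in>S. \<Sum>j\<in>S. Poly_Mapping.single (quad_monomial i j) (sqrt c * sqrt c)) = \<dots>" .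
  qed
  also have "\<dots> = (\<Sum>i<n. \<Sum>S\<in>?F. \<Sum>j<n. Poly_Mapping.single (quad_monomial i j) (if {i, j} \<subseteq> S then c else 0))"
    by (rule sum.swap)
  also have "\<dots> = (\<Sum>i<n. \<Sum>j<n. \<Sum>S\<in>?F. Poly_Mapping.single (quad_monomial i j) (if {i, j} \<subseteq> S then c else 0))"
    by (intro sum.cong[OF refl] sum.swap)
  also have "\<dots> = quad_poly n (\<lambda>i j. c * real (card {S. S \<subseteq> {..<n} \<and> card S = k \<and> {i, j} \<subseteq> S}))"
    unfolding quad_poly_def sum_single
  proof (intro sum.cong[OF refl] arg_cong2[where f = Poly_Mapping.single, OF refl])
    fix i j
    have "(\<Sum>S\<in>?F. if {i, j} \<subseteq> S then c else 0) = (\<Sum>S\<in>{S \<in> ?F. {i, j} \<subseteq> S}. c)"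
      by (rule sum.inter_filter[symmetric]) simp
    then show "(\<Sum>S\<in>?F. if {i, j} \<subseteq> S then c else 0) =
        c * real (card {S. S \<subseteq> {..<n} \<and> card S = k \<and> {i, j} \<subseteq> S})"
      by (simp add: conj_ac mult.commute)
  qed
  finally show ?thesis .
qed

lemma sos_k_nomial_mono:
  assumes "sum_of_squares_of_k_nomials n k p" "k \<le> l"
  shows "sum_of_squares_of_k_nomials n l p"
proof -
  have "k_nomial n l q" if q: "k_nomial n k q" for q
  proof -
    obtain \<alpha> m where m: "\<forall>j<k. monomial_in n (m j)" "q = (\<Sum>j<k. Poly_Mapping.single (m j) (\<alpha> j))"
      using q unfolding k_nomial_def by blast
    let ?m = "\<lambda>j. if j < k then m j else 0" and ?\<alpha> = "\<lambda>j. if j < k then \<alpha> j else 0"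
    have "(\<Sum>j<l. Poly_Mapping.single (?m j) (?\<alpha> j)) = q"
      unfolding m(2) by (rule sum.mono_neutral_cong_right) (use assms(2) in auto)
    moreover have "\<forall>j<l. monomial_in n (?m j)" using m(1) by (simp add: monomial_in_def)
    ultimately show ?thesis
      unfolding k_nomial_def by (intro exI[of _ ?\<alpha>] exI[of _ ?m] conjI) auto
  qed
  moreover obtain N :: nat and q where "\<forall>j<N. k_nomial n k (q j)" "p = (\<Sum>j<N. q j ^ 2)"
    using assms(1) unfolding sum_of_squares_of_k_nomials_def by blast
  ultimately show ?thesis
    unfolding sum_of_squares_of_k_nomials_def by (intro exI[of _ N] exI[of _ q]) simp
qed

definition symmetric_matrix :: "real \<Rightarrow> real \<Rightarrow> nat \<Rightarrow> nat \<Rightarrow> real" where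
  "symmetric_matrix \<alpha> \<beta> i j = (if i = j then \<alpha> else \<beta>)"

text \<open>The sum over \<open>k\<close>-subsets has diagonal and off-diagonal entries in the ratio
  \<open>n - 1\<close> to \<open>k - 1\<close>. Once it is scaled to match \<open>\<beta>\<close>,
  the hypothesis \<open>le\<close> makes the remaining diagonal nonnegative.\<close>

lemma sos_symmetric_nonneg_off_diagonal:
  assumes k: "2 \<le> k" "k \<le> n" and \<beta>: "0 \<le> \<beta>"
    and le: "\<beta> * (real n - 1) \<le> \<alpha> * (real k - 1)"
  shows "sum_of_squares_of_k_nomials n k (quad_poly n (symmetric_matrix \<alpha> \<beta>))"
proof -
  \<comment> \<open>These count the \<open>k\<close>-subsets containing a given index and a given
    pair of indices.\<close>
  let ?A = "real ((n - 1) choose (k - 1))" and ?B = "real ((n - 2) choose (k - 2))"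
  define c where "c = \<beta> / ?B"
  have B: "0 < ?B" using k by simp
  have "(k - 1) * ((n - 1) choose (k - 1)) = (n - 1) * ((n - 2) choose (k - 2))"
    using times_binomial_minus1_eq[of "k - 1" "n - 1"] k by (simp add: numeral_2_eq_2)
  then have AB: "(real k - 1) * ?A = (real n - 1) * ?B"
    using k by (metis (no_types, lifting) of_nat_1 of_nat_diff of_nat_mult one_le_numeral order_trans)
  have "c * ?A * (real k - 1) = c * ((real k - 1) * ?A)" by simp
  also have "\<dots> = \<beta> * (real n - 1)" unfolding AB using B by (simp add: c_def)
  finally have "c * ?A * (real k - 1) \<le> \<alpha> * (real k - 1)" using le by simp
  then have A_le: "c * ?A \<le> \<alpha>" using k by simp
  have eq: "quad_poly n (symmetric_matrix \<alpha> \<beta>) =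
      quad_poly n (\<lambda>i j. c * real (card {S. S \<subseteq> {..<n} \<and> card S = k \<and> {i, j} \<subseteq> S}))
      + quad_poly n (\<lambda>i j. if i = j then \<alpha> - c * ?A else 0)"
    unfolding quad_poly_add[symmetric]
  proof (rule quad_poly_cong)
    fix i j assume ij: "i < n" "j < n"
    show "symmetric_matrix \<alpha> \<beta> i j = c * real (card {S. S \<subseteq> {..<n} \<and> card S = k \<and> {i, j} \<subseteq> S})
        + (if i = j then \<alpha> - c * ?A else 0)"
    proof (cases "i = j")
      case True
      then show ?thesis
        using card_subsets_containing[of "{i}" "{..<n}" k] ij k by (simp add: symmetric_matrix_def)
    next
      case False
      then have "card {i, j} = 2" by simp
      then have "real (card {S. S \<subseteq> {..<n} \<and> card S = k \<and> {i, j} \<subseteq> S}) = ?B"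
        using card_subsets_containing[of "{i, j}" "{..<n}" k] ij k(1) by simp
      then show ?thesis
        using B False unfolding c_def symmetric_matrix_def by (simp only: if_False) simp
    qed
  qed
  show ?thesis
    unfolding eq using A_le k \<beta> B
    by (intro sos_k_nomial_add sos_quad_poly_subset_sums sos_quad_poly_diagonal) (auto simp: c_def)
qed

lemma sum_diagonal_constant:
  fixes \<beta> :: real
  assumes "i < n"
  shows "(\<Sum>j<n. if i = j then \<alpha> else \<beta>) = \<alpha> + (real n - 1) * \<beta>"
proof -
  have "(\<Sum>j<n. if i = j then \<alpha> else \<beta>) = (\<Sum>j<n. (if i = j then \<alpha> - \<beta> else 0) + \<beta>)"
    by (rule sum.cong) auto
  then show ?thesis using assms by (simp add: sum.distrib algebra_simps)
qed

text \<open>Grouping the coefficients by parity class turns this into Cauchy--Schwarz: at most \<open>k\<close>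
  classes occur, so \<open>k\<close> times the sum of the squared class sums dominates the squared total.\<close>

lemma psd_weight_class:
  "psd_weight n k (\<lambda>u. if u = {} then real k - 1 else - 1)"
  unfolding psd_weight_def
proof (intro allI impI)
  fix u :: "nat \<Rightarrow> nat set" and c :: "nat \<Rightarrow> real"
  let ?w = "\<lambda>u :: nat set. if u = {} then real k - 1 else - 1"
  let ?s = "\<lambda>v. \<Sum>i\<in>{i \<in> {..<k}. u i = v}. c i"
  have sd: "sym_diff (u i) (u j) = {} \<longleftrightarrow> u j = u i" for i j by auto
  have "(\<Sum>i<k. \<Sum>j<k. c i * c j * ?w (sym_diff (u i) (u j))) =
      (\<Sum>i<k. \<Sum>j<k. real k * (c i * (if u j = u i then c j else 0)) - c i * c j)"
    by (intro sum.cong[OF refl]) (unfold sd, simp add: algebra_simps)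
  also have "\<dots> = real k * (\<Sum>i<k. c i * ?s (u i)) - (\<Sum>i<k. c i)\<^sup>2"
  proof -
    have "?s (u i) = (\<Sum>j<k. if u j = u i then c j else 0)" for i
      by (rule sum.inter_filter) simp
    then show ?thesis
      unfolding sum_subtractf sum_distrib_left[symmetric] power2_eq_square sum_product by simp
  qed
  also have "(\<Sum>i<k. c i * ?s (u i)) = (\<Sum>v\<in>u ` {..<k}. (?s v)\<^sup>2)"
  proof -
    have "(\<Sum>i<k. c i * ?s (u i)) = (\<Sum>v\<in>u ` {..<k}. \<Sum>i\<in>{i \<in> {..<k}. u i = v}. c i * ?s (u i))"
      by (rule sum.image_gen) simp
    also have "\<dots> = (\<Sum>v\<in>u ` {..<k}. (?s v)\<^sup>2)"
      unfolding power2_eq_square sum_distrib_right[of c]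
      by (intro sum.cong[OF refl]) auto
    finally show ?thesis .
  qed
  also have "(\<Sum>i<k. c i) = (\<Sum>v\<in>u ` {..<k}. ?s v)"
    by (rule sum.image_gen) simp
  finally have eq: "(\<Sum>i<k. \<Sum>j<k. c i * c j * ?w (sym_diff (u i) (u j))) =
    real k * (\<Sum>v\<in>u ` {..<k}. (?s v)\<^sup>2) - (\<Sum>v\<in>u ` {..<k}. ?s v)\<^sup>2" .
  have "(\<Sum>v\<in>u ` {..<k}. ?s v)\<^sup>2 \<le> real (card (u ` {..<k})) * (\<Sum>v\<in>u ` {..<k}. (?s v)\<^sup>2)"
    using sum_squared_le_sum_of_squares[of ?s "u ` {..<k}"] by (simp add: mult.commute)
  also have "\<dots> \<le> real k * (\<Sum>v\<in>u ` {..<k}. (?s v)\<^sup>2)"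
    using card_image_le[of "{..<k}" u] by (intro mult_right_mono sum_nonneg) auto
  finally show "0 \<le> (\<Sum>i<k. \<Sum>j<k. c i * c j * ?w (sym_diff (u i) (u j)))"
    unfolding eq by simp
qed

text \<open>Plain evaluation at the all-ones vector and at \<open>(1, -1, 0, ...)\<close> makes both
  eigenvalues nonnegative; the class weight adds \<open>par\<close>. For \<open>k \<ge> 2\<close>,
  diagonal dominance settles \<open>\<beta> \<le> 0\<close> and sums over subsets settle
  \<open>\<beta> \<ge> 0\<close>.\<close>

lemma sos_symmetric_of_G_power_mult:
  assumes k: "1 \<le> k"
    and sos: "sum_of_squares_of_k_nomials n k (G n ^ r * quad_poly n (symmetric_matrix \<alpha> \<beta>))"
  shows "sum_of_squares_of_k_nomials n k (quad_poly n (symmetric_matrix \<alpha> \<beta>))"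
proof (cases "n \<le> 1")
  case True
  have "quad_poly n (symmetric_matrix \<alpha> \<beta>) = quad_poly n (\<lambda>i j. if i = j then \<alpha> else 0)"
    by (rule quad_poly_cong) (use True in \<open>auto simp: symmetric_matrix_def\<close>)
  moreover have "0 \<le> \<alpha>" if "0 < n"
    using weighted_form_nonneg[OF sos psd_weight_one, of "\<lambda>_. 1"] True that
    by (cases n) (auto simp: symmetric_matrix_def)
  ultimately show ?thesis using k by (auto intro: sos_quad_poly_diagonal)
next
  case False
  then have n: "2 \<le> n" by simp
  have total: "(\<Sum>i<n. \<Sum>j<n. if i = j then x else y) = real n * (x + (real n - 1) * y)" for x y :: real
    by (simp add: sum_diagonal_constant)
  have sum_nonneg: "0 \<le> \<alpha> + (real n - 1) * \<beta>"
    using weighted_form_nonneg[OF sos psd_weight_one, of "\<lambda>_. 1"] n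
    by (simp add: symmetric_matrix_def total zero_le_mult_iff)
  have diff_nonneg: "\<beta> \<le> \<alpha>"
  proof -
    define z :: "nat \<Rightarrow> real" where "z = (\<lambda>i. if i = 0 then 1 else if i = 1 then -1 else 0)"
    have "(\<Sum>i<n. \<Sum>j<n. symmetric_matrix \<alpha> \<beta> i j * 1 * z i * z j) =
      (\<Sum>i\<in>{0, 1}. \<Sum>j\<in>{0, 1}. symmetric_matrix \<alpha> \<beta> i j * 1 * z i * z j)"
    proof (rule sum.mono_neutral_cong_right)
      fix i
      show "(\<Sum>j<n. symmetric_matrix \<alpha> \<beta> i j * 1 * z i * z j) =
        (\<Sum>j\<in>{0, 1}. symmetric_matrix \<alpha> \<beta> i j * 1 * z i * z j)"
        by (rule sum.mono_neutral_right) (use n in \<open>auto simp: z_def\<close>)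
    qed (use n in \<open>auto simp: z_def\<close>)
    then show ?thesis
      using weighted_form_nonneg[OF sos psd_weight_one, of z] by (simp add: z_def symmetric_matrix_def)
  qed
  have "(\<Sum>i<n. \<Sum>j<n. symmetric_matrix \<alpha> \<beta> i j *
      (if (if i = j then {} else {i, j}) = {} then real k - 1 else - 1) * 1 * 1) =
      (\<Sum>i<n. \<Sum>j<n. if i = j then \<alpha> * (real k - 1) else - \<beta>)"
    by (intro sum.cong[OF refl]) (auto simp: symmetric_matrix_def)
  then have "0 \<le> real n * (\<alpha> * (real k - 1) + (real n - 1) * - \<beta>)"
    using weighted_form_nonneg[OF sos psd_weight_class, of "\<lambda>_. 1"] unfolding total by simp
  then have par: "\<beta> * (real n - 1) \<le> \<alpha> * (real k - 1)"
    using n by (simp add: zero_le_mult_iff mult.commute)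
  consider "k = 1" | "2 \<le> k" "\<beta> \<le> 0" | "2 \<le> k" "0 \<le> \<beta>" using k by linarith
  then show ?thesis
  proof cases
    case 1
    \<comment> \<open>For \<open>k = 1\<close> a weight need only satisfy
      \<open>0 \<le> w {}\<close>. This one bounds \<open>\<beta>\<close> below by 0, while
      \<open>par\<close> bounds it above by 0.\<close>
    have "psd_weight n k (\<lambda>u. if u = {} then 0 else 1)"
      by (auto simp: psd_weight_def 1)
    have "(\<Sum>i<n. \<Sum>j<n. symmetric_matrix \<alpha> \<beta> i j *
        (if (if i = j then {} else {i, j}) = {} then 0 else 1) * 1 * 1) =
        (\<Sum>i<n. \<Sum>j<n. if i = j then 0 else \<beta>)"
      by (intro sum.cong[OF refl]) (auto simp: symmetric_matrix_def)
    then have "0 \<le> (\<Sum>i<n. \<Sum>j<n. if i = j then 0 else \<beta>)"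
      using weighted_form_nonneg[OF sos \<open>psd_weight n k _\<close>, of "\<lambda>_. 1"] by simp
    then have "0 \<le> \<beta>" using n unfolding total by (simp add: zero_le_mult_iff)
    then have "\<beta> = 0" using par n 1 by (simp add: mult_le_0_iff)
    then have "symmetric_matrix \<alpha> \<beta> = (\<lambda>i j. if i = j then \<alpha> else 0)"
      by (auto simp: symmetric_matrix_def fun_eq_iff)
    then show ?thesis
      using sos_quad_poly_diagonal[of k n "\<lambda>_. \<alpha>"] diff_nonneg \<open>\<beta> = 0\<close> k by simp
  next
    case 2
    show ?thesis
    proof (rule sos_quad_poly_diagonally_dominant[where d = "\<lambda>_. 1"])
      fix i assume "i < n"
      have "(\<Sum>j<n. if j = i then 0 else \<bar>symmetric_matrix \<alpha> \<beta> i j\<bar> * 1) = (\<Sum>j<n. if i = j then 0 else - \<beta>)"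
        by (intro sum.cong[OF refl]) (use 2 in \<open>auto simp: symmetric_matrix_def\<close>)
      then show "(\<Sum>j<n. if j = i then 0 else \<bar>symmetric_matrix \<alpha> \<beta> i j\<bar> * 1) \<le> symmetric_matrix \<alpha> \<beta> i i * 1"
        using sum_nonneg \<open>i < n\<close> by (simp add: sum_diagonal_constant symmetric_matrix_def)
    qed (use 2 in \<open>auto simp: symmetric_matrix_def\<close>)
  next
    case 3
    show ?thesis
    proof (cases "k \<le> n")
      case True
      then show ?thesis using sos_symmetric_nonneg_off_diagonal 3 par by blast
    next
      case False
      \<comment> \<open>For \<open>k > n\<close> the criterion for \<open>n\<close>-nomials is used
        instead; it reduces to \<open>\<beta> \<le> \<alpha>\<close>.\<close>
      have "\<beta> * (real n - 1) \<le> \<alpha> * (real n - 1)"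
        using diff_nonneg n by (intro mult_right_mono) auto
      then have "sum_of_squares_of_k_nomials n n (quad_poly n (symmetric_matrix \<alpha> \<beta>))"
        using sos_symmetric_nonneg_off_diagonal[of n n] n 3 by blast
      then show ?thesis using sos_k_nomial_mono False by simp
    qed
  qed
qed

section \<open>The cone dual to factor width less than the dimension\<close>

definition outer_square :: "real^'n \<Rightarrow> real^'n^'n" where
  "outer_square v = (\<chi> i j. v $ i * v $ j)"

definition qform :: "real^'n^'n \<Rightarrow> real^'n \<Rightarrow> real" where
  "qform Y v = (Y *v v) \<bullet> v"

text \<open>Equivalently, all principal submatrices of size one less than the dimension are positive
  semidefinite. Among symmetric matrices this is the dual of
  \<open>factor_width_cone\<close>.\<close>

definition sparse_psd :: "real^'n^'n \<Rightarrow> bool" where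
  "sparse_psd Y \<longleftrightarrow> transpose Y = Y \<and> (\<forall>v. (\<exists>i. v $ i = 0) \<longrightarrow> 0 \<le> qform Y v)"

lemma inner_outer_square: "Y \<bullet> outer_square v = qform Y v"
  by (simp add: inner_vec_def outer_square_def qform_def matrix_vector_mult_def sum_distrib_left mult_ac)

lemma qform_diff_outer: "qform (Y - c *\<^sub>R outer_square u) v = qform Y v - c * (u \<bullet> v)\<^sup>2"
proof -
  have "qform (outer_square u) v = (u \<bullet> v)\<^sup>2"
    by (simp add: qform_def outer_square_def matrix_vector_mult_def inner_vec_def power2_eq_square
        sum_product sum_distrib_left sum_distrib_right mult_ac)
  moreover have "qform (Y - c *\<^sub>R outer_square u) v = qform Y v - c * qform (outer_square u) v"
    by (simp add: inner_outer_square[symmetric] inner_diff_left)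
  ultimately show ?thesis by simp
qed

lemma qform_scaleR: "qform Y (c *\<^sub>R v) = c\<^sup>2 * qform Y v"
  by (simp add: qform_def power2_eq_square matrix_vector_mult_scaleR)

lemma transpose_nth: "transpose Y = Y \<Longrightarrow> Y $ i $ j = Y $ j $ i"
  by (metis transpose_def vec_lambda_beta)

lemma qform_add_axis:
  assumes "transpose Y = Y"
  shows "qform Y (v + s *\<^sub>R axis l 1) = qform Y v + 2 * s * (Y $ l \<bullet> v) + s\<^sup>2 * Y $ l $ l"
proof -
  have 1: "Y *v axis l 1 = Y $ l"
    using transpose_nth[OF assms] by (simp add: vec_eq_iff matrix_vector_mul_component inner_axis)
  have 2: "(Y *v v) \<bullet> axis l 1 = Y $ l \<bullet> v"
    by (simp add: inner_axis matrix_vector_mul_component)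
  show ?thesis
    by (simp add: qform_def matrix_vector_right_distrib matrix_vector_mult_scaleR 1 inner_add_left
        inner_add_right 2 power2_eq_square algebra_simps)
       (simp add: inner_axis)
qed

lemma qform_axis: "transpose Y = Y \<Longrightarrow> qform Y (axis l 1) = Y $ l $ l"
  using qform_add_axis[of Y 0 1 l] by (simp add: qform_def)

text \<open>Near zero a linear term outweighs a quadratic one; \<open>s = - b / t\<close> is close
  enough to exhibit a negative value.\<close>

lemma linear_coeff_zero:
  fixes a b c :: real
  assumes "\<And>s. 0 \<le> 2 * s * b + s\<^sup>2 * a"
  shows "b = 0"
proof (rule ccontr)
  assume b: "b \<noteq> 0"
  define t where "t = 1 + \<bar>a\<bar>"
  have t: "0 < t" "a < t" by (auto simp: t_def)
  have "0 \<le> 2 * (- b / t) * b + (- b / t)\<^sup>2 * a" by (rule assms)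
  also have "\<dots> = b\<^sup>2 / t * (a / t - 2)"
    using t by (simp add: field_simps power2_eq_square)
  also have "\<dots> < 0"
    using t b by (intro mult_pos_neg) (auto simp: field_simps)
  finally show False by simp
qed

text \<open>It lets \<open>sparse_psd\<close> be applied to vectors supported on the coordinates
  \<open>i\<close> and \<open>j\<close>.\<close>

lemma exists_third:
  assumes "3 \<le> CARD('n::finite)"
  shows "\<exists>k::'n. k \<noteq> i \<and> k \<noteq> j"
proof (rule ccontr)
  assume "\<not> ?thesis"
  then have "(UNIV :: 'n set) \<subseteq> {i, j}" by blast
  then have "CARD('n) \<le> card {i, j}" by (intro card_mono) auto
  also have "\<dots> \<le> 2" by (simp add: card_insert_if)
  finally show False using assms by simp
qed

lemma sparse_psd_diag_nonneg:
  fixes Y :: "real^'n^'n"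
  assumes "sparse_psd Y" "3 \<le> CARD('n)"
  shows "0 \<le> Y $ i $ i"
proof -
  obtain k where "k \<noteq> i" using exists_third[OF assms(2), of i i] by blast
  then have "axis i (1 :: real) $ k = 0" by (simp add: axis_def)
  then have "0 \<le> qform Y (axis i 1)"
    using assms(1) unfolding sparse_psd_def by blast
  then show ?thesis using assms(1) by (simp add: qform_axis sparse_psd_def)
qed

text \<open>Testing on \<open>axis i 1\<close> plus or minus \<open>axis j 1\<close> bounds entries
  by the diagonal. This makes the slice of trace 1 bounded.\<close>

lemma sparse_psd_entry_bound:
  fixes Y :: "real^'n^'n"
  assumes "sparse_psd Y" "3 \<le> CARD('n)"
  shows "\<bar>Y $ i $ j\<bar> \<le> trace Y"
proof -
  have sym: "transpose Y = Y" using assms(1) by (simp add: sparse_psd_def)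
  have nonneg: "0 \<le> Y $ k $ k" for k by (rule sparse_psd_diag_nonneg[OF assms])
  have diag: "Y $ k $ k \<le> trace Y" for k
    unfolding trace_def by (rule member_le_sum) (auto simp: nonneg)
  obtain k where k: "k \<noteq> i" "k \<noteq> j" using exists_third[OF assms(2)] by metis
  have "0 \<le> qform Y (axis i 1 + s *\<^sub>R axis j 1)" for s
  proof -
    have "(axis i 1 + s *\<^sub>R axis j 1) $ k = 0" using k by (simp add: axis_def)
    then show ?thesis using assms(1) unfolding sparse_psd_def by blast
  qed
  then have "0 \<le> Y $ i $ i + 2 * s * Y $ j $ i + s\<^sup>2 * Y $ j $ j" for s
    by (simp add: qform_add_axis[OF sym] qform_axis[OF sym] inner_axis)
  from this[of 1] this[of "-1"] have "2 * \<bar>Y $ j $ i\<bar> \<le> Y $ i $ i + Y $ j $ j" by auto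
  then show ?thesis using diag[of i] diag[of j] transpose_nth[OF sym, of i j] by simp
qed

lemma sparse_psd_zero_diag:
  fixes Y :: "real^'n^'n"
  assumes "sparse_psd Y" "3 \<le> CARD('n)" "Y $ l $ l = 0"
  shows "Y $ l $ j = 0"
proof (rule linear_coeff_zero)
  fix s
  have sym: "transpose Y = Y" using assms(1) by (simp add: sparse_psd_def)
  obtain k where k: "k \<noteq> l" "k \<noteq> j" using exists_third[OF assms(2)] by metis
  have "(axis l 1 + s *\<^sub>R axis j 1) $ k = 0" using k by (simp add: axis_def)
  then have "0 \<le> qform Y (axis l 1 + s *\<^sub>R axis j 1)"
    using assms(1) unfolding sparse_psd_def by blast
  then show "0 \<le> 2 * s * Y $ l $ j + s\<^sup>2 * Y $ j $ j"
    using transpose_nth[OF sym, of l j]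
    by (simp add: qform_add_axis[OF sym] qform_axis[OF sym] inner_axis assms(3))
qed

lemma sparse_psd_trace_nonneg:
  fixes Y :: "real^'n^'n"
  assumes "sparse_psd Y" "3 \<le> CARD('n)"
  shows "0 \<le> trace Y"
  unfolding trace_def by (intro sum_nonneg sparse_psd_diag_nonneg[OF assms])

lemma sparse_psd_trace_eq_0:
  fixes Y :: "real^'n^'n"
  assumes "sparse_psd Y" "3 \<le> CARD('n)" "trace Y = 0"
  shows "Y = 0"
  using sparse_psd_entry_bound[OF assms(1,2)] assms(3) by (simp add: vec_eq_iff)

lemma sparse_psd_scaleR: "sparse_psd Y \<Longrightarrow> 0 \<le> c \<Longrightarrow> sparse_psd (c *\<^sub>R Y)"
  by (auto simp: sparse_psd_def qform_def scaleR_matrix_vector_assoc[symmetric] transpose_def vec_eq_iff)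

lemma trace_scaleR: "trace (c *\<^sub>R (Y :: real^'n^'n)) = c * trace Y"
  by (simp add: trace_def sum_distrib_left)

text \<open>Restricting to unit vectors gives a compact base, from which closedness of the cone
  follows.\<close>

definition factor_width_cone :: "(real^'n^'n) set" where
  "factor_width_cone = conic hull (convex hull (outer_square ` {v. norm v = 1 \<and> (\<exists>i. v $ i = 0)}))"

lemma closed_factor_width_cone: "closed (factor_width_cone :: (real^'n^'n) set)"
proof -
  let ?V = "{v :: real^'n. norm v = 1 \<and> (\<exists>i. v $ i = 0)}"
  have "?V = sphere 0 1 \<inter> (\<Union>i. {v. v $ i = 0})" by auto
  moreover have "closed {v :: real^'n. v $ i = 0}" for i
    by (intro closed_Collect_eq continuous_intros)
  ultimately have "compact ?V" by (auto intro!: compact_Int_closed closed_UN)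
  moreover have "continuous_on ?V outer_square"
    unfolding outer_square_def by (intro continuous_intros)
  ultimately have "compact (outer_square ` ?V)" by (rule compact_continuous_image[rotated])
  then have "compact (convex hull (outer_square ` ?V))" by (rule compact_convex_hull)
  \<comment> \<open>Pairing with the identity is the trace, equal to 1 on all generators; so the
    base avoids the origin.\<close>
  moreover have "convex hull (outer_square ` ?V) \<subseteq> {A. mat 1 \<bullet> A = 1}"
  proof (rule hull_minimal)
    show "outer_square ` ?V \<subseteq> {A. mat 1 \<bullet> A = 1}"
      by (auto simp: inner_outer_square qform_def dot_square_norm)
    show "convex {A :: real^'n^'n. mat 1 \<bullet> A = 1}" by (rule convex_hyperplane)
  qed
  then have "0 \<notin> convex hull (outer_square ` ?V)" by auto
  ultimately show ?thesis unfolding factor_width_cone_def by (intro closed_conic_hull) auto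
qed

lemma outer_square_in_factor_width_cone:
  fixes v :: "real^'n"
  assumes "v $ i = 0" "0 \<le> t" "3 \<le> CARD('n)"
  shows "t *\<^sub>R outer_square v \<in> factor_width_cone"
proof -
  let ?B = "outer_square ` {v :: real^'n. norm v = 1 \<and> (\<exists>i. v $ i = 0)}"
  have unit: "c *\<^sub>R outer_square w \<in> factor_width_cone"
    if "0 \<le> c" "norm w = 1" "w $ k = 0" for c k and w :: "real^'n"
  proof -
    have "outer_square w \<in> convex hull ?B" using that by (intro hull_inc) auto
    then show ?thesis unfolding factor_width_cone_def conic_hull_explicit using that(1) by blast
  qed
  show ?thesis
  proof (cases "v = 0")
    case True
    obtain k where "k \<noteq> i" using exists_third[OF assms(3), of i i] by blast
    then have "0 *\<^sub>R outer_square (axis i 1 :: real^'n) \<in> factor_width_cone"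
      by (intro unit[where k = k]) (auto simp: axis_def norm_axis_1[unfolded axis_def])
    moreover have "outer_square v = 0" using True by (simp add: outer_square_def vec_eq_iff)
    ultimately show ?thesis by simp
  next
    case False
    have "(t * (norm v)\<^sup>2) *\<^sub>R outer_square ((1 / norm v) *\<^sub>R v) \<in> factor_width_cone"
      by (rule unit[where k = i]) (use assms False in auto)
    also have "(t * (norm v)\<^sup>2) *\<^sub>R outer_square ((1 / norm v) *\<^sub>R v) = t *\<^sub>R outer_square v"
      using False by (simp add: outer_square_def vec_eq_iff power2_eq_square)
    finally show ?thesis .
  qed
qed

lemma inner_transpose: "transpose A \<bullet> B = A \<bullet> transpose (B :: real^'n^'n)"
  unfolding inner_vec_def transpose_def by (simp, subst sum.swap) simp

text \<open>A hyperplane separates \<open>Q\<close> from the closed convex cone, and invariance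
  under scaling makes the functional nonnegative there. Adding the transpose makes it symmetric and
  doubles its values at \<open>Q\<close> and on squares.\<close>

lemma factor_width_cone_separation:
  fixes Q :: "real^'n^'n"
  assumes "Q \<notin> factor_width_cone" "transpose Q = Q" "3 \<le> CARD('n)"
  obtains Y where "sparse_psd Y" "Y \<bullet> Q < 0"
proof -
  have "convex (factor_width_cone :: (real^'n^'n) set)"
    unfolding factor_width_cone_def by (intro convex_conic_hull convex_convex_hull)
  from separating_hyperplane_closed_point[OF this closed_factor_width_cone assms(1)]
  obtain a b where a: "a \<bullet> Q < b" "\<And>x. x \<in> factor_width_cone \<Longrightarrow> b < a \<bullet> x" by blast
  have "0 *\<^sub>R outer_square (0 :: real^'n) \<in> factor_width_cone"
    by (rule outer_square_in_factor_width_cone[where i = undefined]) (use assms in auto)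
  then have b: "b < 0" using a(2)[of 0] by simp
  have pos: "0 \<le> qform a v" if v: "v $ i = 0" for v i
  proof (rule ccontr)
    assume neg: "\<not> ?thesis"
    \<comment> \<open>At this point of the cone the functional equals \<open>b\<close>, although it
      must exceed \<open>b\<close> there.\<close>
    have "(b / qform a v) *\<^sub>R outer_square v \<in> factor_width_cone"
      using b neg by (intro outer_square_in_factor_width_cone[OF v _ assms(3)])
        (auto intro: divide_nonpos_neg less_imp_le)
    then show False using a(2) neg by (fastforce simp: inner_outer_square)
  qed
  have T: "transpose a \<bullet> Q = a \<bullet> Q" by (simp add: inner_transpose assms(2))
  have q: "qform (a + transpose a) v = 2 * qform a v" for v
  proof -
    have "transpose a \<bullet> outer_square v = a \<bullet> outer_square v"
      unfolding inner_transpose by (simp add: transpose_def outer_square_def mult.commute)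
    then show ?thesis by (simp add: inner_outer_square[symmetric] inner_add_left)
  qed
  show thesis
  proof (rule that[of "a + transpose a"])
    show "sparse_psd (a + transpose a)"
      using pos by (auto simp: sparse_psd_def q) (simp add: transpose_def vec_eq_iff add.commute)
    show "(a + transpose a) \<bullet> Q < 0" using a(1) b by (simp add: inner_add_left T)
  qed
qed

section \<open>Extremal separating functionals\<close>

lemma continuous_on_qform: "continuous_on S (qform Y)"
  unfolding qform_def by (intro continuous_intros)

text \<open>Among the separating functionals of trace \<open>1\<close> we take one with the least value at \<open>Q\<close>; it
  plays the role of an extreme ray, since no positive multiple of a square on which \<open>Q\<close> is
  nonnegative can be split off from it.\<close>

lemma sparse_psd_minimiser:
  fixes Q :: "real^'n^'n"
  assumes "sparse_psd Y0" "Y0 \<bullet> Q < 0" "3 \<le> CARD('n)"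
  obtains Y where "sparse_psd Y" "Y \<bullet> Q < 0" "trace Y = 1"
    "\<And>Z :: real^'n^'n. sparse_psd Z \<Longrightarrow> (Y \<bullet> Q) * trace Z \<le> Z \<bullet> Q"
proof -
  let ?D = "{Y :: real^'n^'n. sparse_psd Y \<and> trace Y = 1}"
  have normalise: "(1 / trace Z) *\<^sub>R Z \<in> ?D" "0 < trace Z" if "sparse_psd Z" "Z \<noteq> 0" for Z :: "real^'n^'n"
  proof -
    show tr: "0 < trace Z"
      using sparse_psd_trace_nonneg[OF that(1) assms(3)] sparse_psd_trace_eq_0[OF that(1) assms(3)] that(2)
      by fastforce
    show "(1 / trace Z) *\<^sub>R Z \<in> ?D" using tr that by (simp add: sparse_psd_scaleR trace_scaleR)
  qed
  have "?D = {Y :: real^'n^'n. transpose Y = Y} \<inter> {Y. trace Y = 1} \<inter> (\<Inter>v\<in>{v. \<exists>i. v $ i = 0}. {Y. 0 \<le> Y \<bullet> outer_square v})"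
    by (auto simp: sparse_psd_def inner_outer_square)
  moreover have "closed {Y :: real^'n^'n. transpose Y = Y}" "closed {Y :: real^'n^'n. trace Y = 1}"
    unfolding transpose_def trace_def by (intro closed_Collect_eq continuous_intros)+
  moreover have "closed {Y. 0 \<le> Y \<bullet> outer_square v}" for v :: "real^'n"
    by (intro closed_Collect_le continuous_intros)
  ultimately have closed: "closed ?D" by (auto intro!: closed_Int closed_INT)
  have "norm Y \<le> real (CARD('n) * CARD('n))" if Y: "Y \<in> ?D" for Y
  proof -
    have "norm Y \<le> (\<Sum>i\<in>UNIV. norm (Y $ i))" unfolding norm_vec_def by (rule L2_set_le_sum) simp
    also have "\<dots> \<le> (\<Sum>i\<in>(UNIV :: 'n set). real CARD('n))"
    proof (rule sum_mono)
      fix i :: 'n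
      have "norm (Y $ i) \<le> (\<Sum>j\<in>UNIV. \<bar>Y $ i $ j\<bar>)" by (rule norm_le_l1_cart)
      also have "\<dots> \<le> (\<Sum>j\<in>(UNIV :: 'n set). 1)"
        using sparse_psd_entry_bound[OF _ assms(3), of Y] Y by (intro sum_mono) auto
      finally show "norm (Y $ i) \<le> real CARD('n)" by simp
    qed
    finally show ?thesis by simp
  qed
  then have "bounded ?D" unfolding bounded_iff by blast
  with closed have "compact ?D" by (simp add: compact_eq_bounded_closed)
  moreover have "Y0 \<noteq> 0" using assms(2) by auto
  then have Y1: "(1 / trace Y0) *\<^sub>R Y0 \<in> ?D" "0 < trace Y0" using normalise[OF assms(1)] by auto
  moreover have "continuous_on ?D (\<lambda>Y. Y \<bullet> Q)" by (intro continuous_intros)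
  ultimately obtain Y where Y: "Y \<in> ?D" "\<And>Z. Z \<in> ?D \<Longrightarrow> Y \<bullet> Q \<le> Z \<bullet> Q"
    using continuous_attains_inf[of ?D "\<lambda>Y. Y \<bullet> Q"] by blast
  show thesis
  proof (rule that)
    show "sparse_psd Y" "trace Y = 1" using Y by simp_all
    have "Y \<bullet> Q \<le> ((1 / trace Y0) *\<^sub>R Y0) \<bullet> Q" by (rule Y(2)[OF Y1(1)])
    also have "\<dots> < 0" using assms(2) Y1(2) by (simp add: divide_neg_pos)
    finally show "Y \<bullet> Q < 0" .
  next
    fix Z :: "real^'n^'n" assume Z: "sparse_psd Z"
    show "(Y \<bullet> Q) * trace Z \<le> Z \<bullet> Q"
    proof (cases "Z = 0")
      case True
      then show ?thesis by (simp add: trace_def)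
    next
      case False
      then show ?thesis
        using Y(2)[OF normalise(1)[OF Z False]] normalise(2)[OF Z False] by (simp add: pos_le_divide_eq)
    qed
  qed
qed

text \<open>Complete the square along \<open>axis l 1\<close>. The square of row \<open>l\<close>
  over its pivot can thus be split off wherever moving in that direction is permitted.\<close>

lemma row_square_le:
  assumes "transpose Y = Y" "0 < Y $ l $ l" "\<And>s. 0 \<le> qform Y (v + s *\<^sub>R axis l 1)"
  shows "(Y $ l \<bullet> v)\<^sup>2 / Y $ l $ l \<le> qform Y v"
proof -
  have "0 \<le> qform Y (v + (- (Y $ l \<bullet> v) / Y $ l $ l) *\<^sub>R axis l 1)" by (rule assms(3))
  also have "\<dots> = qform Y v - (Y $ l \<bullet> v)\<^sup>2 / Y $ l $ l"
    unfolding qform_add_axis[OF assms(1)] using assms(2) by (simp add: field_simps power2_eq_square)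
  finally show ?thesis by simp
qed

text \<open>Splitting off a square lowers the trace and does not raise the value at the semidefinite
  \<open>Q\<close>. As the minimum per unit of trace is negative, the remainder would violate
  \<open>min\<close>.\<close>

lemma minimiser_no_split:
  fixes Q Y :: "real^'n^'n"
  assumes card: "3 \<le> CARD('n)" and Q: "\<And>v. 0 \<le> qform Q v"
    and Y: "sparse_psd Y" "Y \<bullet> Q < 0" "trace Y = 1"
    and min: "\<And>Z. sparse_psd Z \<Longrightarrow> (Y \<bullet> Q) * trace Z \<le> Z \<bullet> Q"
    and u: "u \<noteq> 0" and \<epsilon>: "0 < \<epsilon>"
    and nonneg: "\<And>v i. v $ i = 0 \<Longrightarrow> \<epsilon> * (u \<bullet> v)\<^sup>2 \<le> qform Y v"
  shows False
proof -
  let ?Z = "Y - \<epsilon> *\<^sub>R outer_square u"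
  have "sparse_psd ?Z"
    using Y(1) nonneg unfolding sparse_psd_def
    by (auto simp: qform_diff_outer) (auto simp: transpose_def vec_eq_iff outer_square_def mult.commute)
  from min[OF this] have le: "(Y \<bullet> Q) * trace ?Z \<le> ?Z \<bullet> Q" .
  have tr: "trace ?Z = trace Y - \<epsilon> * (norm u)\<^sup>2"
    by (simp add: trace_def outer_square_def sum_subtractf sum_distrib_left power2_norm_eq_inner inner_vec_def)
  have "?Z \<bullet> Q = Y \<bullet> Q - \<epsilon> * qform Q u"
    by (simp add: inner_diff_left inner_outer_square inner_commute[of "outer_square u"])
  then have "(Y \<bullet> Q) * (trace Y - \<epsilon> * (norm u)\<^sup>2) \<le> Y \<bullet> Q"
    using le Q[of u] \<epsilon> unfolding tr by (smt (verit) mult_nonneg_nonneg)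
  then have "0 \<le> (Y \<bullet> Q) * (\<epsilon> * (norm u)\<^sup>2)" by (simp add: Y(3) algebra_simps)
  moreover have "0 < \<epsilon> * (norm u)\<^sup>2" using u \<epsilon> by simp
  ultimately show False using Y(2) by (simp add: zero_le_mult_iff)
qed

text \<open>Otherwise the square of a row with positive pivot could be split off.\<close>

lemma minimiser_not_psd:
  fixes Q Y :: "real^'n^'n"
  assumes card: "3 \<le> CARD('n)" and Q: "\<And>v. 0 \<le> qform Q v"
    and Y: "sparse_psd Y" "Y \<bullet> Q < 0" "trace Y = 1"
    and min: "\<And>Z. sparse_psd Z \<Longrightarrow> (Y \<bullet> Q) * trace Z \<le> Z \<bullet> Q"
  shows "\<exists>v. qform Y v < 0"
proof (rule ccontr)
  assume "\<not> ?thesis"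
  then have psd: "0 \<le> qform Y v" for v by (auto simp: not_less)
  have "\<exists>l. Y $ l $ l \<noteq> 0"
  proof (rule ccontr)
    assume "\<not> ?thesis"
    then have "trace Y = 0" by (simp add: trace_def)
    then show False using Y(3) by simp
  qed
  then obtain l where "Y $ l $ l \<noteq> 0" by blast
  then have l: "0 < Y $ l $ l" using sparse_psd_diag_nonneg[OF Y(1) card, of l] by simp
  have sym: "transpose Y = Y" using Y(1) by (simp add: sparse_psd_def)
  show False
  proof (rule minimiser_no_split[OF card Q Y min])
    show "Y $ l \<noteq> 0" using l by auto
    show "0 < 1 / Y $ l $ l" using l by simp
    show "1 / Y $ l $ l * (Y $ l \<bullet> v)\<^sup>2 \<le> qform Y v" for v
      using row_square_le[OF sym l psd, of v] by simp
  qed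
qed

text \<open>A zero diagonal entry kills its row, so \<open>v $ l\<close> could be set to zero
  without changing the negative value.\<close>

lemma sparse_psd_diag_pos:
  fixes Y :: "real^'n^'n"
  assumes card: "3 \<le> CARD('n)" and Y: "sparse_psd Y" and neg: "qform Y v < 0"
  shows "0 < Y $ l $ l"
proof (rule ccontr)
  assume "\<not> ?thesis"
  then have l: "Y $ l $ l = 0" using sparse_psd_diag_nonneg[OF Y card, of l] by simp
  have sym: "transpose Y = Y" using Y by (simp add: sparse_psd_def)
  have row: "Y $ l = 0"
    using sparse_psd_zero_diag[OF Y card l] by (simp add: vec_eq_iff)
  have "qform Y (v + (- v $ l) *\<^sub>R axis l 1) = qform Y v"
    unfolding qform_add_axis[OF sym] by (simp add: row)
  moreover have "(v + (- v $ l) *\<^sub>R axis l 1) $ l = 0" by (simp add: axis_def)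
  ultimately show False using Y neg unfolding sparse_psd_def by (metis not_less)
qed

text \<open>Otherwise \<open>Y\<close> is positive definite on the hyperplane
  \<open>v $ l = 0\<close>, and a small multiple of the square of row \<open>l\<close> splits off:
  there by definiteness, on the other coordinate hyperplanes by \<open>row_square_le\<close>, since
  they contain \<open>axis l 1\<close>.\<close>

lemma minimiser_singular:
  fixes Q Y :: "real^'n^'n"
  assumes card: "3 \<le> CARD('n)" and Q: "\<And>v. 0 \<le> qform Q v"
    and Y: "sparse_psd Y" "Y \<bullet> Q < 0" "trace Y = 1"
    and min: "\<And>Z. sparse_psd Z \<Longrightarrow> (Y \<bullet> Q) * trace Z \<le> Z \<bullet> Q"
  obtains v where "v \<noteq> 0" "v $ l = 0" "qform Y v = 0"
proof (rule ccontr)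
  assume "\<not> thesis"
  note neg = this
  have sym: "transpose Y = Y" using Y(1) by (simp add: sparse_psd_def)
  have psd: "0 \<le> qform Y v" if "v $ i = 0" for v i
    using Y(1) that unfolding sparse_psd_def by blast
  have l: "0 < Y $ l $ l"
    using minimiser_not_psd[OF card Q Y min] sparse_psd_diag_pos[OF card Y(1)] by blast
  have u: "Y $ l \<noteq> 0" using l by auto
  let ?S = "{v :: real^'n. norm v = 1 \<and> v $ l = 0}"
  have "?S = sphere 0 1 \<inter> {v. v $ l = 0}" by auto
  moreover have "closed {v :: real^'n. v $ l = 0}" by (intro closed_Collect_eq continuous_intros)
  ultimately have "compact ?S" by auto
  moreover obtain k where "k \<noteq> l" using exists_third[OF card, of l l] by blast
  then have "axis k 1 \<in> ?S" by (simp add: norm_axis_1) (simp add: axis_def)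
  then have "?S \<noteq> {}" by blast
  ultimately obtain w where w: "w \<in> ?S" "\<And>v. v \<in> ?S \<Longrightarrow> qform Y w \<le> qform Y v"
    using continuous_attains_inf[of ?S "qform Y"] continuous_on_qform by blast
  define m where "m = qform Y w"
  have "w \<noteq> 0" using w by auto
  then have m: "0 < m" using neg that[of w] psd[of w l] w unfolding m_def by fastforce
  have bound: "m * (norm v)\<^sup>2 \<le> qform Y v" if "v $ l = 0" for v
  proof (cases "v = 0")
    case True
    then show ?thesis by (simp add: qform_def)
  next
    case False
    have "m \<le> qform Y ((1 / norm v) *\<^sub>R v)" unfolding m_def by (rule w(2)) (use False that in simp)
    then show ?thesis using False by (simp add: qform_scaleR field_simps)
  qed
  \<comment> \<open>The first bound serves the hyperplanes with \<open>i \<noteq> l\<close>, the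
    second the one with \<open>i = l\<close>, through Cauchy-Schwarz.\<close>
  define \<epsilon> where "\<epsilon> = min (1 / Y $ l $ l) (m / (norm (Y $ l))\<^sup>2)"
  show False
  proof (rule minimiser_no_split[OF card Q Y min u])
    show "0 < \<epsilon>" using l m u by (simp add: \<epsilon>_def)
    fix v :: "real^'n" and i assume v: "v $ i = 0"
    show "\<epsilon> * (Y $ l \<bullet> v)\<^sup>2 \<le> qform Y v"
    proof (cases "i = l")
      case True
      have "\<epsilon> * (Y $ l \<bullet> v)\<^sup>2 \<le> (m / (norm (Y $ l))\<^sup>2) * (norm (Y $ l) * norm v)\<^sup>2"
        using Cauchy_Schwarz_ineq2[of "Y $ l" v] m
        by (intro mult_mono) (auto simp: \<epsilon>_def abs_le_square_iff[symmetric])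
      also have "\<dots> = m * (norm v)\<^sup>2" using u by (simp add: power_mult_distrib)
      also have "\<dots> \<le> qform Y v" using bound v True by blast
      finally show ?thesis .
    next
      case False
      have "\<epsilon> * (Y $ l \<bullet> v)\<^sup>2 \<le> 1 / Y $ l $ l * (Y $ l \<bullet> v)\<^sup>2"
        by (intro mult_right_mono) (auto simp: \<epsilon>_def)
      also have "\<dots> = (Y $ l \<bullet> v)\<^sup>2 / Y $ l $ l" by simp
      also have "\<dots> \<le> qform Y v"
      proof (rule row_square_le[OF sym l])
        fix s
        have "(v + s *\<^sub>R axis l 1) $ i = 0" using v False by (simp add: axis_def)
        then show "0 \<le> qform Y (v + s *\<^sub>R axis l 1)" by (rule psd)
      qed
      finally show ?thesis .
    qed
  qed
qed

section \<open>Singular quaternary functionals and the Klein four-group\<close>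

definition ternary_psd :: "real \<Rightarrow> real \<Rightarrow> real \<Rightarrow> real \<Rightarrow> real \<Rightarrow> real \<Rightarrow> bool" where
  "ternary_psd a b c d e f \<longleftrightarrow> (\<forall>x y z.
     0 \<le> a * x\<^sup>2 + b * y\<^sup>2 + c * z\<^sup>2 + 2 * d * x * y + 2 * e * x * z + 2 * f * y * z)"

text \<open>At a zero of a nonnegative form the gradient vanishes, so the zero is a kernel vector;
  by Cramer's rule the determinant annihilates each of its coordinates.\<close>

lemma ternary_psd_singular:
  assumes psd: "ternary_psd a b c d e f"
    and zero: "a * x\<^sup>2 + b * y\<^sup>2 + c * z\<^sup>2 + 2 * d * x * y + 2 * e * x * z + 2 * f * y * z = 0"
    and nz: "x \<noteq> 0 \<or> y \<noteq> 0 \<or> z \<noteq> 0"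
  shows "a * b * c + 2 * d * e * f - a * f\<^sup>2 - b * e\<^sup>2 - c * d\<^sup>2 = 0" (is "?D = 0")
proof -
  note q = psd[unfolded ternary_psd_def, rule_format]
  have r1: "a * x + d * y + e * z = 0"
  proof (rule linear_coeff_zero)
    fix s show "0 \<le> 2 * s * (a * x + d * y + e * z) + s\<^sup>2 * a"
      using q[of "x + s" y z] zero by (simp add: power2_eq_square algebra_simps)
  qed
  have r2: "d * x + b * y + f * z = 0"
  proof (rule linear_coeff_zero)
    fix s show "0 \<le> 2 * s * (d * x + b * y + f * z) + s\<^sup>2 * b"
      using q[of x "y + s" z] zero by (simp add: power2_eq_square algebra_simps)
  qed
  have r3: "e * x + f * y + c * z = 0"
  proof (rule linear_coeff_zero)
    fix s show "0 \<le> 2 * s * (e * x + f * y + c * z) + s\<^sup>2 * c"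
      using q[of x y "z + s"] zero by (simp add: power2_eq_square algebra_simps)
  qed
  have "?D * x = 0" using r1 r2 r3 by algebra
  moreover have "?D * y = 0" using r1 r2 r3 by algebra
  moreover have "?D * z = 0" using r1 r2 r3 by algebra
  ultimately show ?thesis using nz by auto
qed

text \<open>With \<open>a, b, c\<close> the cosines and \<open>A, B, C\<close> the sines of three angles, \<open>p, q, r\<close> are the
  cosines of their pairwise sums, \<open>\<kappa>\<close> and \<open>\<sigma>\<close> are the cosine and the sine of the total, and the
  determinant equals \<open>4 A B C \<sigma>\<close>.\<close>

lemma cosines_of_pairwise_sums:
  fixes a b c A B C p q r :: real
  assumes sq: "A\<^sup>2 = 1 - a\<^sup>2" "B\<^sup>2 = 1 - b\<^sup>2" "C\<^sup>2 = 1 - c\<^sup>2"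
    and nz: "A \<noteq> 0" "B \<noteq> 0" "C \<noteq> 0"
    and pqr: "p = a * b - A * B" "q = a * c - A * C" "r = b * c - B * C"
    and det: "1 + 2 * p * q * r - p\<^sup>2 - q\<^sup>2 - r\<^sup>2 = 0"
  shows "\<exists>\<kappa>. \<kappa>\<^sup>2 = 1 \<and> r = \<kappa> * a \<and> q = \<kappa> * b \<and> p = \<kappa> * c"
proof -
  define \<kappa> where "\<kappa> = a * b * c - a * B * C - b * A * C - c * A * B"
  define \<sigma> where "\<sigma> = A * b * c + B * a * c + C * a * b - A * B * C"
  have "1 + 2 * p * q * r - p\<^sup>2 - q\<^sup>2 - r\<^sup>2 = 4 * A * B * C * \<sigma>"
    using sq unfolding pqr \<sigma>_def by algebra
  then have \<sigma>: "\<sigma> = 0" using det nz by simp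
  have "\<kappa>\<^sup>2 + \<sigma>\<^sup>2 = 1"
    using sq unfolding \<kappa>_def \<sigma>_def by algebra
  then have "\<kappa>\<^sup>2 = 1" using \<sigma> by simp
  moreover have "r = \<kappa> * a + \<sigma> * A" "q = \<kappa> * b + \<sigma> * B" "p = \<kappa> * c + \<sigma> * C"
    using sq unfolding pqr \<kappa>_def \<sigma>_def by algebra+
  ultimately show ?thesis using \<sigma> by auto
qed

text \<open>The matrix has unit diagonal, \<open>p, q, r\<close> at 12, 13, 23 and
  \<open>a, b, c\<close> at 14, 24, 34, and its principal 3 by 3 minors vanish. Eliminating index 4
  leaves off-diagonal entries \<open>A * B\<close>, \<open>A * C\<close>, \<open>B * C\<close> up to
  signs. By \<open>neg\<close> the product of these signs is negative, and flipping coordinates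
  leads to \<open>cosines_of_pairwise_sums\<close>.\<close>

lemma klein_normalised:
  fixes a b c p q r :: real
  assumes le: "a\<^sup>2 \<le> 1" "b\<^sup>2 \<le> 1" "c\<^sup>2 \<le> 1"
    and pqr: "(p - a * b)\<^sup>2 = (1 - a\<^sup>2) * (1 - b\<^sup>2)" "(q - a * c)\<^sup>2 = (1 - a\<^sup>2) * (1 - c\<^sup>2)"
      "(r - b * c)\<^sup>2 = (1 - b\<^sup>2) * (1 - c\<^sup>2)"
    and det: "1 + 2 * p * q * r - p\<^sup>2 - q\<^sup>2 - r\<^sup>2 = 0"
    and neg: "x\<^sup>2 + y\<^sup>2 + z\<^sup>2 + w\<^sup>2 + 2 * p * x * y + 2 * q * x * z + 2 * r * y * z
      + 2 * a * x * w + 2 * b * y * w + 2 * c * z * w < 0"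
  shows "\<exists>s t \<kappa>. s\<^sup>2 = 1 \<and> t\<^sup>2 = 1 \<and> \<kappa>\<^sup>2 = 1 \<and>
    s * t * r = \<kappa> * a \<and> t * q = \<kappa> * s * b \<and> s * p = \<kappa> * t * c"
proof -
  define A where "A = sqrt (1 - a\<^sup>2)"
  define B where "B = sqrt (1 - b\<^sup>2)"
  define C where "C = sqrt (1 - c\<^sup>2)"
  have sq: "A\<^sup>2 = 1 - a\<^sup>2" "B\<^sup>2 = 1 - b\<^sup>2" "C\<^sup>2 = 1 - c\<^sup>2" using le by (simp_all add: A_def B_def C_def)
  have schur: "A\<^sup>2 * x\<^sup>2 + B\<^sup>2 * y\<^sup>2 + C\<^sup>2 * z\<^sup>2 + 2 * (p - a * b) * x * y + 2 * (q - a * c) * x * z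
      + 2 * (r - b * c) * y * z < 0"
  proof -
    have "A\<^sup>2 * x\<^sup>2 + B\<^sup>2 * y\<^sup>2 + C\<^sup>2 * z\<^sup>2 + 2 * (p - a * b) * x * y + 2 * (q - a * c) * x * z
      + 2 * (r - b * c) * y * z + (w + a * x + b * y + c * z)\<^sup>2 =
      x\<^sup>2 + y\<^sup>2 + z\<^sup>2 + w\<^sup>2 + 2 * p * x * y + 2 * q * x * z + 2 * r * y * z
      + 2 * a * x * w + 2 * b * y * w + 2 * c * z * w"
      unfolding sq by (simp add: power2_eq_square algebra_simps)
    moreover have "0 \<le> (w + a * x + b * y + c * z)\<^sup>2" by simp
    ultimately show ?thesis using neg by linarith
  qed
  \<comment> \<open>With signs of product 1 the complement is a perfect square.\<close>
  have no: False if "s\<^sup>2 = 1" "t\<^sup>2 = 1" "p - a * b = s * (A * B)" "q - a * c = t * (A * C)"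
    "r - b * c = s * t * (B * C)" for s t
  proof -
    have "A\<^sup>2 * x\<^sup>2 + B\<^sup>2 * y\<^sup>2 + C\<^sup>2 * z\<^sup>2 + 2 * (p - a * b) * x * y + 2 * (q - a * c) * x * z
      + 2 * (r - b * c) * y * z = (A * x + s * B * y + t * C * z)\<^sup>2"
      unfolding that(3-5) using that(1,2) by algebra
    then show False using schur by (metis not_less zero_le_power2)
  qed
  have "(p - a * b)\<^sup>2 = (A * B)\<^sup>2" "(q - a * c)\<^sup>2 = (A * C)\<^sup>2" "(r - b * c)\<^sup>2 = (B * C)\<^sup>2"
    by (simp_all add: pqr power_mult_distrib sq)
  then have "\<exists>s. s\<^sup>2 = 1 \<and> p - a * b = s * (A * B)" "\<exists>t. t\<^sup>2 = 1 \<and> q - a * c = t * (A * C)"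
    "\<exists>u. u\<^sup>2 = 1 \<and> r - b * c = u * (B * C)"
    by (auto simp: power2_eq_iff intro: exI[of _ 1] exI[of _ "-1"])
  then obtain s t u where stu: "s\<^sup>2 = 1" "t\<^sup>2 = 1" "u\<^sup>2 = 1"
    and eqs: "p - a * b = s * (A * B)" "q - a * c = t * (A * C)" "r - b * c = u * (B * C)" by blast
  have "u \<noteq> s * t" using no[OF stu(1,2) eqs(1,2)] eqs(3) by blast
  moreover have "u = s * t \<or> u = - (s * t)"
    using stu by (metis power2_eq_iff power_mult_distrib mult_1)
  ultimately have u: "u = - (s * t)" by blast
  \<comment> \<open>If a factor vanished, a sign could be flipped freely and \<open>no\<close> would
    apply.\<close>
  have "A \<noteq> 0" using no[of "- s" t] stu eqs u by auto
  moreover have "B \<noteq> 0" using no[of "- s" t] stu eqs u by auto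
  moreover have "C \<noteq> 0" using no[of s "- t"] stu eqs u by auto
  \<comment> \<open>Multiplying coordinates 2 and 3 by \<open>- s\<close> and \<open>- t\<close>
    makes all three signs negative.\<close>
  moreover have "(- s * b)\<^sup>2 = b\<^sup>2" "(- t * c)\<^sup>2 = c\<^sup>2" using stu by (simp_all add: power_mult_distrib)
  moreover have "- s * p = a * (- s * b) - A * B" "- t * q = a * (- t * c) - A * C"
    "s * t * r = (- s * b) * (- t * c) - B * C"
    using stu eqs unfolding u by algebra+
  moreover have "1 + 2 * (- s * p) * (- t * q) * (s * t * r) - (- s * p)\<^sup>2 - (- t * q)\<^sup>2 - (s * t * r)\<^sup>2 = 0"
    using det stu by algebra
  ultimately obtain \<kappa> where "\<kappa>\<^sup>2 = 1" "s * t * r = \<kappa> * a" "- t * q = \<kappa> * (- s * b)" "- s * p = \<kappa> * (- t * c)"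
    using cosines_of_pairwise_sums[of A a B "- s * b" C "- t * c" "- s * p" "- t * q" "s * t * r"] sq by auto
  then show ?thesis using stu by (intro exI[of _ "s"] exI[of _ "t"] exI[of _ \<kappa>]) auto
qed

text \<open>The bits compare membership of \<open>0, 1, 2\<close> with that of \<open>3\<close>,
  hence are invariant under complementation within the four variables. The pair
  \<open>{0, 1}\<close> gets \<open>\<alpha>\<close>, \<open>{0, 2}\<close> gets
  \<open>\<beta>\<close> and \<open>{1, 2}\<close> gets \<open>\<gamma>\<close>, as do their
  complements.\<close>

definition klein_weight :: "real \<Rightarrow> real \<Rightarrow> real \<Rightarrow> nat set \<Rightarrow> real" where
  "klein_weight \<alpha> \<beta> \<gamma> u =
    (case ((0 \<in> u) \<noteq> (3 \<in> u), (1 \<in> u) \<noteq> (3 \<in> u), (2 \<in> u) \<noteq> (3 \<in> u)) of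
      (False, False, False) \<Rightarrow> 1 | (True, True, False) \<Rightarrow> \<alpha> | (True, False, True) \<Rightarrow> \<beta>
    | (False, True, True) \<Rightarrow> \<gamma> | _ \<Rightarrow> 0)"

lemma ternary_psd_swap:
  "ternary_psd 1 1 1 a b c \<Longrightarrow> ternary_psd 1 1 1 b a c"
  "ternary_psd 1 1 1 a b c \<Longrightarrow> ternary_psd 1 1 1 a c b"
proof -
  assume "ternary_psd 1 1 1 a b c"
  note T = this[unfolded ternary_psd_def, rule_format]
  show "ternary_psd 1 1 1 b a c"
    unfolding ternary_psd_def
  proof (intro allI)
    fix x y z show "0 \<le> 1 * x\<^sup>2 + 1 * y\<^sup>2 + 1 * z\<^sup>2 + 2 * b * x * y + 2 * a * x * z + 2 * c * y * z"
      using T[of x z y] by (simp add: algebra_simps)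
  qed
  show "ternary_psd 1 1 1 a c b"
    unfolding ternary_psd_def
  proof (intro allI)
    fix x y z show "0 \<le> 1 * x\<^sup>2 + 1 * y\<^sup>2 + 1 * z\<^sup>2 + 2 * a * x * y + 2 * c * x * z + 2 * b * y * z"
      using T[of y x z] by (simp add: algebra_simps)
  qed
qed

lemma ternary_psd_abs_le:
  assumes "ternary_psd 1 1 1 a b c"
  shows "\<bar>a\<bar> \<le> 1"
  using assms[unfolded ternary_psd_def, rule_format, of 1 1 0]
    assms[unfolded ternary_psd_def, rule_format, of 1 "-1" 0] by auto

text \<open>The first matrix arises when two of three subsets are equivalent, the second when one
  differs in parity from the other two.\<close>

lemma ternary_psd_degenerate:
  assumes "\<bar>f\<bar> \<le> 1"
  shows "ternary_psd 1 1 1 1 f f" "ternary_psd 1 1 1 f 0 0"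
proof -
  have f: "f\<^sup>2 \<le> 1" using assms by (simp add: abs_square_le_1)
  have sq: "0 \<le> (1 - f\<^sup>2) * x\<^sup>2" for x using f by simp
  show "ternary_psd 1 1 1 1 f f"
    unfolding ternary_psd_def
  proof (intro allI)
    fix x y z :: real
    have "1 * x\<^sup>2 + 1 * y\<^sup>2 + 1 * z\<^sup>2 + 2 * 1 * x * y + 2 * f * x * z + 2 * f * y * z
      = (x + y + f * z)\<^sup>2 + (1 - f\<^sup>2) * z\<^sup>2" by (simp add: power2_eq_square algebra_simps)
    then show "0 \<le> 1 * x\<^sup>2 + 1 * y\<^sup>2 + 1 * z\<^sup>2 + 2 * 1 * x * y + 2 * f * x * z + 2 * f * y * z"
      using sq[of z] by simp
  qed
  show "ternary_psd 1 1 1 f 0 0"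
    unfolding ternary_psd_def
  proof (intro allI)
    fix x y z :: real
    have "1 * x\<^sup>2 + 1 * y\<^sup>2 + 1 * z\<^sup>2 + 2 * f * x * y + 2 * 0 * x * z + 2 * 0 * y * z
      = (x + f * y)\<^sup>2 + (1 - f\<^sup>2) * y\<^sup>2 + z\<^sup>2" by (simp add: power2_eq_square algebra_simps)
    also have "\<dots> \<ge> 0" using sq[of y] by (intro add_nonneg_nonneg) auto
    finally show "0 \<le> 1 * x\<^sup>2 + 1 * y\<^sup>2 + 1 * z\<^sup>2 + 2 * f * x * y + 2 * 0 * x * z + 2 * 0 * y * z" .
  qed
qed

text \<open>Up to complementation the even subsets of the four variables form a Klein four-group, on
  which the weight takes the values \<open>1, \<alpha>, \<beta>, \<gamma>\<close>; it vanishes on the odd subsets. The three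
  differences of three subsets are thus \<open>g\<close>, \<open>h\<close> and \<open>g + h\<close>, and only the matrix with
  entries \<open>\<alpha>, \<beta>, \<gamma>\<close> and degenerate ones occur.\<close>

lemma ternary_psd_klein_weight:
  assumes "ternary_psd 1 1 1 \<alpha> \<beta> \<gamma>"
  shows "ternary_psd 1 1 1 (klein_weight \<alpha> \<beta> \<gamma> (sym_diff u v)) (klein_weight \<alpha> \<beta> \<gamma> (sym_diff u w))
    (klein_weight \<alpha> \<beta> \<gamma> (sym_diff v w))"
proof -
  let ?T = "ternary_psd 1 1 1"
  have perm: "?T \<alpha> \<beta> \<gamma>" "?T \<alpha> \<gamma> \<beta>" "?T \<beta> \<alpha> \<gamma>" "?T \<beta> \<gamma> \<alpha>" "?T \<gamma> \<alpha> \<beta>" "?T \<gamma> \<beta> \<alpha>"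
    using assms ternary_psd_swap by blast+
  have le: "\<bar>\<alpha>\<bar> \<le> 1" "\<bar>\<beta>\<bar> \<le> 1" "\<bar>\<gamma>\<bar> \<le> 1" "\<bar>1 :: real\<bar> \<le> 1" "\<bar>0 :: real\<bar> \<le> 1"
    using perm(1,3,5) by (auto dest: ternary_psd_abs_le)
  have deg: "?T 1 f f" "?T f 1 f" "?T f f 1" "?T f 0 0" "?T 0 f 0" "?T 0 0 f" if "\<bar>f\<bar> \<le> 1" for f
    using ternary_psd_degenerate[OF that] ternary_psd_swap by blast+
  note deg' = le[THEN deg(1)] le[THEN deg(2)] le[THEN deg(3)] le[THEN deg(4)] le[THEN deg(5)] le[THEN deg(6)]
  define g0 g1 g2 where "g0 = ((0 \<in> sym_diff u v) \<noteq> (3 \<in> sym_diff u v))"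
    and "g1 = ((1 \<in> sym_diff u v) \<noteq> (3 \<in> sym_diff u v))"
    and "g2 = ((2 \<in> sym_diff u v) \<noteq> (3 \<in> sym_diff u v))"
  define h0 h1 h2 where "h0 = ((0 \<in> sym_diff u w) \<noteq> (3 \<in> sym_diff u w))"
    and "h1 = ((1 \<in> sym_diff u w) \<noteq> (3 \<in> sym_diff u w))"
    and "h2 = ((2 \<in> sym_diff u w) \<noteq> (3 \<in> sym_diff u w))"
  have gh: "((0 \<in> sym_diff v w) \<noteq> (3 \<in> sym_diff v w)) = (g0 \<noteq> h0)"
    "((1 \<in> sym_diff v w) \<noteq> (3 \<in> sym_diff v w)) = (g1 \<noteq> h1)"
    "((2 \<in> sym_diff v w) \<noteq> (3 \<in> sym_diff v w)) = (g2 \<noteq> h2)"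
    unfolding g0_def g1_def g2_def h0_def h1_def h2_def by auto
  show ?thesis
    unfolding klein_weight_def gh g0_def[symmetric] g1_def[symmetric] g2_def[symmetric]
      h0_def[symmetric] h1_def[symmetric] h2_def[symmetric]
    by (cases g0; cases g1; cases g2; cases h0; cases h1; cases h2) (simp_all add: perm deg')
qed

lemma psd_weight_klein:
  assumes "ternary_psd 1 1 1 \<alpha> \<beta> \<gamma>"
  shows "psd_weight n 3 (klein_weight \<alpha> \<beta> \<gamma>)"
  unfolding psd_weight_def
proof (intro allI impI)
  fix u :: "nat \<Rightarrow> nat set" and c :: "nat \<Rightarrow> real"
  let ?w = "klein_weight \<alpha> \<beta> \<gamma>"
  have comm: "?w (sym_diff (u j) (u i)) = ?w (sym_diff (u i) (u j))" for i j by (simp add: Un_commute)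
  have diag: "?w {} = 1" by (simp add: klein_weight_def)
  have "(\<Sum>i<3. \<Sum>j<3. c i * c j * ?w (sym_diff (u i) (u j))) =
    1 * (c 0)\<^sup>2 + 1 * (c 1)\<^sup>2 + 1 * (c 2)\<^sup>2 + 2 * ?w (sym_diff (u 0) (u 1)) * c 0 * c 1
    + 2 * ?w (sym_diff (u 0) (u 2)) * c 0 * c 2 + 2 * ?w (sym_diff (u 1) (u 2)) * c 1 * c 2"
    unfolding numeral_3_eq_3 lessThan_Suc lessThan_0
    using comm[of 1 0] comm[of 2 0] comm[of 2 1]
    by (simp add: diag power2_eq_square numeral_2_eq_2[symmetric] One_nat_def[symmetric]
        del: One_nat_def)
  also have "\<dots> \<ge> 0"
    by (rule ternary_psd_klein_weight[OF assms, unfolded ternary_psd_def, rule_format])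
  finally show "0 \<le> (\<Sum>i<3. \<Sum>j<3. c i * c j * ?w (sym_diff (u i) (u j)))" .
qed

text \<open>Scaling rows and columns by \<open>d, e, f\<close> multiplies the determinant by
  \<open>(d * e * f)^2\<close>.\<close>

lemma ternary_det_unscale:
  fixes d e f p q r :: real
  assumes "d \<noteq> 0" "e \<noteq> 0" "f \<noteq> 0"
    and "d\<^sup>2 * e\<^sup>2 * f\<^sup>2 + 2 * (d * e * p) * (d * f * q) * (e * f * r) - d\<^sup>2 * (e * f * r)\<^sup>2
      - e\<^sup>2 * (d * f * q)\<^sup>2 - f\<^sup>2 * (d * e * p)\<^sup>2 = 0"
  shows "1 + 2 * p * q * r - p\<^sup>2 - q\<^sup>2 - r\<^sup>2 = 0"
proof -
  have "(d * e * f)\<^sup>2 * (1 + 2 * p * q * r - p\<^sup>2 - q\<^sup>2 - r\<^sup>2) = 0"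
    using assms(4) by (simp add: power2_eq_square algebra_simps)
  then show ?thesis using assms(1-3) by simp
qed

lemma qform_4:
  fixes Y :: "real^4^4"
  assumes "transpose Y = Y"
  shows "qform Y v = Y $ 1 $ 1 * (v $ 1)\<^sup>2 + Y $ 2 $ 2 * (v $ 2)\<^sup>2 + Y $ 3 $ 3 * (v $ 3)\<^sup>2
    + Y $ 4 $ 4 * (v $ 4)\<^sup>2 + 2 * Y $ 1 $ 2 * v $ 1 * v $ 2 + 2 * Y $ 1 $ 3 * v $ 1 * v $ 3
    + 2 * Y $ 2 $ 3 * v $ 2 * v $ 3 + 2 * Y $ 1 $ 4 * v $ 1 * v $ 4 + 2 * Y $ 2 $ 4 * v $ 2 * v $ 4
    + 2 * Y $ 3 $ 4 * v $ 3 * v $ 4"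
  using transpose_nth[OF assms, of 2 1] transpose_nth[OF assms, of 3 1] transpose_nth[OF assms, of 4 1]
    transpose_nth[OF assms, of 3 2] transpose_nth[OF assms, of 4 2] transpose_nth[OF assms, of 4 3]
  by (simp add: inner_outer_square[symmetric] inner_vec_def sum_4 outer_square_def power2_eq_square
      algebra_simps)

lemma obtain_vector_4:
  obtains v :: "real^4" where "v $ 1 = a" "v $ 2 = b" "v $ 3 = c" "v $ 4 = d"
proof
  let ?v = "\<chi> i::4. if i = 1 then a else if i = 2 then b else if i = 3 then c else d"
  show "?v $ 1 = a" "?v $ 2 = b" "?v $ 3 = c" "?v $ 4 = d" by simp_all
qed

text \<open>After scaling to unit diagonal, the vanishing minors and the negative value at
  \<open>v0\<close> are the hypotheses of \<open>klein_normalised\<close>. Its signs are absorbed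
  into \<open>z2, z3, z4\<close>, so that entries at complementary index pairs share a
  weight.\<close>

lemma minimiser_klein_form:
  fixes Q Y :: "real^4^4"
  assumes Q: "\<And>v. 0 \<le> qform Q v"
    and Y: "sparse_psd Y" "Y \<bullet> Q < 0" "trace Y = 1"
    and min: "\<And>Z :: real^4^4. sparse_psd Z \<Longrightarrow> (Y \<bullet> Q) * trace Z \<le> Z \<bullet> Q"
  obtains z1 z2 z3 z4 \<alpha> \<beta> \<gamma> where "ternary_psd 1 1 1 \<alpha> \<beta> \<gamma>"
    "Y $ 1 $ 1 = z1\<^sup>2" "Y $ 2 $ 2 = z2\<^sup>2" "Y $ 3 $ 3 = z3\<^sup>2" "Y $ 4 $ 4 = z4\<^sup>2"
    "Y $ 1 $ 2 = \<alpha> * z1 * z2" "Y $ 3 $ 4 = \<alpha> * z3 * z4" "Y $ 1 $ 3 = \<beta> * z1 * z3"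
    "Y $ 2 $ 4 = \<beta> * z2 * z4" "Y $ 2 $ 3 = \<gamma> * z2 * z3" "Y $ 1 $ 4 = \<gamma> * z1 * z4"
proof -
  have card: "3 \<le> CARD(4)" by simp
  have sym: "transpose Y = Y" using Y(1) by (simp add: sparse_psd_def)
  note q = qform_4[OF sym]
  obtain v0 where v0: "qform Y v0 < 0" using minimiser_not_psd[OF card Q Y min] by blast
  have pos: "0 < Y $ l $ l" for l by (rule sparse_psd_diag_pos[OF card Y(1) v0])
  have psd: "0 \<le> qform Y v" if "v $ i = 0" for v i
    using Y(1) that unfolding sparse_psd_def by blast
  have P: "ternary_psd (Y$1$1) (Y$2$2) (Y$3$3) (Y$1$2) (Y$1$3) (Y$2$3)"
    "ternary_psd (Y$1$1) (Y$2$2) (Y$4$4) (Y$1$2) (Y$1$4) (Y$2$4)"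
    "ternary_psd (Y$1$1) (Y$3$3) (Y$4$4) (Y$1$3) (Y$1$4) (Y$3$4)"
    "ternary_psd (Y$2$2) (Y$3$3) (Y$4$4) (Y$2$3) (Y$2$4) (Y$3$4)"
    unfolding ternary_psd_def
  proof (safe)
    fix x y z :: real
    obtain v :: "real^4" where v: "v $ 1 = x" "v $ 2 = y" "v $ 3 = z" "v $ 4 = 0" by (rule obtain_vector_4)
    show "0 \<le> Y$1$1 * x\<^sup>2 + Y$2$2 * y\<^sup>2 + Y$3$3 * z\<^sup>2 + 2 * Y$1$2 * x * y + 2 * Y$1$3 * x * z + 2 * Y$2$3 * y * z"
      using psd[OF v(4)] by (simp add: q v)
  next
    fix x y z :: real
    obtain v :: "real^4" where v: "v $ 1 = x" "v $ 2 = y" "v $ 3 = 0" "v $ 4 = z" by (rule obtain_vector_4)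
    show "0 \<le> Y$1$1 * x\<^sup>2 + Y$2$2 * y\<^sup>2 + Y$4$4 * z\<^sup>2 + 2 * Y$1$2 * x * y + 2 * Y$1$4 * x * z + 2 * Y$2$4 * y * z"
      using psd[OF v(3)] by (simp add: q v)
  next
    fix x y z :: real
    obtain v :: "real^4" where v: "v $ 1 = x" "v $ 2 = 0" "v $ 3 = y" "v $ 4 = z" by (rule obtain_vector_4)
    show "0 \<le> Y$1$1 * x\<^sup>2 + Y$3$3 * y\<^sup>2 + Y$4$4 * z\<^sup>2 + 2 * Y$1$3 * x * y + 2 * Y$1$4 * x * z + 2 * Y$3$4 * y * z"
      using psd[OF v(2)] by (simp add: q v)
  next
    fix x y z :: real
    obtain v :: "real^4" where v: "v $ 1 = 0" "v $ 2 = x" "v $ 3 = y" "v $ 4 = z" by (rule obtain_vector_4)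
    show "0 \<le> Y$2$2 * x\<^sup>2 + Y$3$3 * y\<^sup>2 + Y$4$4 * z\<^sup>2 + 2 * Y$2$3 * x * y + 2 * Y$2$4 * x * z + 2 * Y$3$4 * y * z"
      using psd[OF v(1)] by (simp add: q v)
  qed
  have nz: "v $ 1 \<noteq> 0 \<or> v $ 2 \<noteq> 0 \<or> v $ 3 \<noteq> 0 \<or> v $ 4 \<noteq> 0" if "v \<noteq> 0" for v :: "real^4"
    using that by (auto simp: vec_eq_iff forall_4)
  note sing = minimiser_singular[OF card Q Y min]
  obtain v where v: "v \<noteq> 0" "v $ 4 = 0" "qform Y v = 0" by (rule sing)
  have D123: "Y$1$1 * Y$2$2 * Y$3$3 + 2 * Y$1$2 * Y$1$3 * Y$2$3 - Y$1$1 * (Y$2$3)\<^sup>2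
      - Y$2$2 * (Y$1$3)\<^sup>2 - Y$3$3 * (Y$1$2)\<^sup>2 = 0"
    by (rule ternary_psd_singular[OF P(1), of "v$1" "v$2" "v$3"]) (use v nz[of v] in \<open>auto simp: q\<close>)
  obtain v where v: "v \<noteq> 0" "v $ 3 = 0" "qform Y v = 0" by (rule sing)
  have D124: "Y$1$1 * Y$2$2 * Y$4$4 + 2 * Y$1$2 * Y$1$4 * Y$2$4 - Y$1$1 * (Y$2$4)\<^sup>2
      - Y$2$2 * (Y$1$4)\<^sup>2 - Y$4$4 * (Y$1$2)\<^sup>2 = 0"
    by (rule ternary_psd_singular[OF P(2), of "v$1" "v$2" "v$4"]) (use v nz[of v] in \<open>auto simp: q\<close>)
  obtain v where v: "v \<noteq> 0" "v $ 2 = 0" "qform Y v = 0" by (rule sing)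
  have D134: "Y$1$1 * Y$3$3 * Y$4$4 + 2 * Y$1$3 * Y$1$4 * Y$3$4 - Y$1$1 * (Y$3$4)\<^sup>2
      - Y$3$3 * (Y$1$4)\<^sup>2 - Y$4$4 * (Y$1$3)\<^sup>2 = 0"
    by (rule ternary_psd_singular[OF P(3), of "v$1" "v$3" "v$4"]) (use v nz[of v] in \<open>auto simp: q\<close>)
  obtain v where v: "v \<noteq> 0" "v $ 1 = 0" "qform Y v = 0" by (rule sing)
  have D234: "Y$2$2 * Y$3$3 * Y$4$4 + 2 * Y$2$3 * Y$2$4 * Y$3$4 - Y$2$2 * (Y$3$4)\<^sup>2
      - Y$3$3 * (Y$2$4)\<^sup>2 - Y$4$4 * (Y$2$3)\<^sup>2 = 0"
    by (rule ternary_psd_singular[OF P(4), of "v$2" "v$3" "v$4"]) (use v nz[of v] in \<open>auto simp: q\<close>)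
  define d where "d i = sqrt (Y $ i $ i)" for i
  define y where "y i j = Y $ i $ j / (d i * d j)" for i j
  have d: "d i \<noteq> 0" "Y $ i $ i = (d i)\<^sup>2" for i
    using pos[of i] by (simp_all add: d_def)
  have y: "Y $ i $ j = d i * d j * y i j" if "i \<noteq> j" for i j
    using d(1)[of i] d(1)[of j] by (simp add: y_def)
  have det: "1 + 2 * y 1 2 * y 1 3 * y 2 3 - (y 1 2)\<^sup>2 - (y 1 3)\<^sup>2 - (y 2 3)\<^sup>2 = 0"
    "1 + 2 * y 1 2 * y 1 4 * y 2 4 - (y 1 2)\<^sup>2 - (y 1 4)\<^sup>2 - (y 2 4)\<^sup>2 = 0"
    "1 + 2 * y 1 3 * y 1 4 * y 3 4 - (y 1 3)\<^sup>2 - (y 1 4)\<^sup>2 - (y 3 4)\<^sup>2 = 0"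
    "1 + 2 * y 2 3 * y 2 4 * y 3 4 - (y 2 3)\<^sup>2 - (y 2 4)\<^sup>2 - (y 3 4)\<^sup>2 = 0"
    using D123 D124 D134 D234
      ternary_det_unscale[OF d(1)[of 1] d(1)[of 2] d(1)[of 3], of "y 1 2" "y 1 3" "y 2 3"]
      ternary_det_unscale[OF d(1)[of 1] d(1)[of 2] d(1)[of 4], of "y 1 2" "y 1 4" "y 2 4"]
      ternary_det_unscale[OF d(1)[of 1] d(1)[of 3] d(1)[of 4], of "y 1 3" "y 1 4" "y 3 4"]
      ternary_det_unscale[OF d(1)[of 2] d(1)[of 3] d(1)[of 4], of "y 2 3" "y 2 4" "y 3 4"]
    by (simp_all add: d(2) y)
  have le1: "(y i j)\<^sup>2 \<le> 1" if ij: "i \<noteq> j" for i j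
  proof -
    have nonneg: "0 \<le> qform Y (axis i 1 + s *\<^sub>R axis j 1)" for s
    proof -
      obtain k where "k \<noteq> i" "k \<noteq> j" using exists_third[OF card] by blast
      then have "(axis i 1 + s *\<^sub>R axis j 1) $ k = 0" by (simp add: axis_def)
      then show ?thesis by (rule psd)
    qed
    have "(Y $ j $ i)\<^sup>2 / Y $ j $ j \<le> Y $ i $ i"
      using row_square_le[OF sym pos nonneg] by (simp add: inner_axis qform_axis[OF sym])
    then have "(Y $ i $ j)\<^sup>2 \<le> Y $ i $ i * Y $ j $ j"
      using pos[of j] transpose_nth[OF sym, of i j] by (simp add: pos_divide_le_eq)
    then show ?thesis
      using pos[of i] pos[of j] by (simp add: y_def power_divide power_mult_distrib d(2)[symmetric])
  qed
  have neg: "(d 1 * v0 $ 1)\<^sup>2 + (d 2 * v0 $ 2)\<^sup>2 + (d 3 * v0 $ 3)\<^sup>2 + (d 4 * v0 $ 4)\<^sup>2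
    + 2 * y 1 2 * (d 1 * v0 $ 1) * (d 2 * v0 $ 2) + 2 * y 1 3 * (d 1 * v0 $ 1) * (d 3 * v0 $ 3)
    + 2 * y 2 3 * (d 2 * v0 $ 2) * (d 3 * v0 $ 3) + 2 * y 1 4 * (d 1 * v0 $ 1) * (d 4 * v0 $ 4)
    + 2 * y 2 4 * (d 2 * v0 $ 2) * (d 4 * v0 $ 4) + 2 * y 3 4 * (d 3 * v0 $ 3) * (d 4 * v0 $ 4) < 0"
    using v0 unfolding q by (simp add: d(2) y power_mult_distrib mult_ac)
  obtain s t \<kappa> where st: "s\<^sup>2 = 1" "t\<^sup>2 = 1" "\<kappa>\<^sup>2 = 1"
    and eqs: "s * t * y 2 3 = \<kappa> * y 1 4" "t * y 1 3 = \<kappa> * s * y 2 4" "s * y 1 2 = \<kappa> * t * y 3 4"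
  proof -
    have "\<exists>s t \<kappa>. s\<^sup>2 = 1 \<and> t\<^sup>2 = 1 \<and> \<kappa>\<^sup>2 = 1 \<and>
      s * t * y 2 3 = \<kappa> * y 1 4 \<and> t * y 1 3 = \<kappa> * s * y 2 4 \<and> s * y 1 2 = \<kappa> * t * y 3 4"
    proof (rule klein_normalised[OF le1 le1 le1 _ _ _ det(1) neg])
      \<comment> \<open>Completing the square in \<open>y 1 2\<close> turns the vanishing minor into
        this identity.\<close>
      show "(y 1 2 - y 1 4 * y 2 4)\<^sup>2 = (1 - (y 1 4)\<^sup>2) * (1 - (y 2 4)\<^sup>2)" using det(2) by algebra
      show "(y 1 3 - y 1 4 * y 3 4)\<^sup>2 = (1 - (y 1 4)\<^sup>2) * (1 - (y 3 4)\<^sup>2)" using det(3) by algebra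
      show "(y 2 3 - y 2 4 * y 3 4)\<^sup>2 = (1 - (y 2 4)\<^sup>2) * (1 - (y 3 4)\<^sup>2)" using det(4) by algebra
    qed auto
    then show thesis using that by blast
  qed
  let ?\<alpha> = "s * y 1 2" and ?\<beta> = "t * y 1 3" and ?\<gamma> = "s * t * y 2 3"
  show thesis
  proof (rule that[of ?\<alpha> ?\<beta> ?\<gamma> "d 1" "s * d 2" "t * d 3" "\<kappa> * d 4"])
    show "ternary_psd 1 1 1 ?\<alpha> ?\<beta> ?\<gamma>"
      unfolding ternary_psd_def
    proof (intro allI)
      fix x1 x2 x3
      have ss: "s * s = 1" "t * t = 1" using st by (simp_all add: power2_eq_square)
      \<comment> \<open>At this point the scaling by \<open>d\<close> and the signs are
        undone.\<close>
      have "0 \<le> Y$1$1 * (x1 / d 1)\<^sup>2 + Y$2$2 * (s * x2 / d 2)\<^sup>2 + Y$3$3 * (t * x3 / d 3)\<^sup>2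
          + 2 * Y$1$2 * (x1 / d 1) * (s * x2 / d 2) + 2 * Y$1$3 * (x1 / d 1) * (t * x3 / d 3)
          + 2 * Y$2$3 * (s * x2 / d 2) * (t * x3 / d 3)"
        using P(1) unfolding ternary_psd_def by blast
      also have "\<dots> = 1 * x1\<^sup>2 + 1 * x2\<^sup>2 + 1 * x3\<^sup>2 + 2 * ?\<alpha> * x1 * x2 + 2 * ?\<beta> * x1 * x3 + 2 * ?\<gamma> * x2 * x3"
        using d(1) by (simp add: d(2) y power_mult_distrib power_divide st mult_ac)
      finally show "0 \<le> 1 * x1\<^sup>2 + 1 * x2\<^sup>2 + 1 * x3\<^sup>2 + 2 * ?\<alpha> * x1 * x2 + 2 * ?\<beta> * x1 * x3 + 2 * ?\<gamma> * x2 * x3" .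
    qed
    show "Y $ 1 $ 1 = (d 1)\<^sup>2" "Y $ 2 $ 2 = (s * d 2)\<^sup>2" "Y $ 3 $ 3 = (t * d 3)\<^sup>2" "Y $ 4 $ 4 = (\<kappa> * d 4)\<^sup>2"
      by (simp_all add: d(2) power_mult_distrib st)
    show "Y $ 1 $ 2 = ?\<alpha> * d 1 * (s * d 2)" "Y $ 1 $ 3 = ?\<beta> * d 1 * (t * d 3)"
      "Y $ 2 $ 3 = ?\<gamma> * (s * d 2) * (t * d 3)"
      using st by (simp_all add: y) algebra+
    have "y 3 4 = \<kappa> * t * (s * y 1 2)" "y 2 4 = \<kappa> * s * (t * y 1 3)" "y 1 4 = \<kappa> * (s * t * y 2 3)"
      using st eqs by algebra+
    then show "Y $ 3 $ 4 = ?\<alpha> * (t * d 3) * (\<kappa> * d 4)" "Y $ 2 $ 4 = ?\<beta> * (s * d 2) * (\<kappa> * d 4)"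
      "Y $ 1 $ 4 = ?\<gamma> * d 1 * (\<kappa> * d 4)"
      by (simp_all add: y mult_ac)
  qed
qed


section \<open>Quaternary forms and trinomials\<close>

lemma sos_quad_poly_scale:
  assumes "sum_of_squares_of_k_nomials n k (quad_poly n a)" "0 \<le> c"
  shows "sum_of_squares_of_k_nomials n k (quad_poly n (\<lambda>i j. c * a i j))"
proof -
  obtain N :: nat and q where q: "\<forall>j<N. k_nomial n k (q j)" "quad_poly n a = (\<Sum>j<N. q j ^ 2)"
    using assms(1) unfolding sum_of_squares_of_k_nomials_def by blast
  let ?s = "\<lambda>t. Poly_Mapping.single 0 t :: rpoly"
  have "k_nomial n k (?s t * p)" if p: "k_nomial n k p" for t p
  proof -
    obtain \<alpha> m where m: "\<forall>j<k. monomial_in n (m j)" "p = (\<Sum>j<k. Poly_Mapping.single (m j) (\<alpha> j))"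
      using p unfolding k_nomial_def by blast
    show ?thesis
      unfolding k_nomial_def
      by (rule exI[of _ "\<lambda>j. t * \<alpha> j"], rule exI[of _ m]) (use m in \<open>simp add: sum_distrib_left mult_single\<close>)
  qed
  moreover have "quad_poly n (\<lambda>i j. c * a i j) = ?s c * quad_poly n a"
    by (simp add: quad_poly_def sum_distrib_left mult_single)
  moreover have "(?s (sqrt c))\<^sup>2 = ?s c"
    using assms(2) by (simp add: power2_eq_square mult_single)
  ultimately show ?thesis
    unfolding sum_of_squares_of_k_nomials_def
    by (intro exI[of _ N] exI[of _ "\<lambda>j. ?s (sqrt c) * q j"]) (simp add: q power_mult_distrib sum_distrib_left)
qed

definition index_4 :: "nat \<Rightarrow> 4" where
  "index_4 i = (if i = 0 then 1 else if i = 1 then 2 else if i = 2 then 3 else 4)"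

text \<open>The set \<open>?P\<close> is a convex cone, so generators suffice; a zero coordinate of
  \<open>v\<close> leaves a linear form in three variables.\<close>

lemma sos_of_factor_width_cone:
  assumes "A \<in> factor_width_cone"
  shows "sum_of_squares_of_k_nomials 4 3 (quad_poly 4 (\<lambda>i j. A $ index_4 i $ index_4 j))"
proof -
  let ?P = "{A. sum_of_squares_of_k_nomials 4 3 (quad_poly 4 (\<lambda>i j. A $ index_4 i $ index_4 j))}"
  have "outer_square v \<in> ?P" if v: "v $ l = 0" for v l
  proof -
    obtain k where k: "k < 4" "index_4 k = l"
    proof -
      have "index_4 0 = 1" "index_4 1 = 2" "index_4 2 = 3" "index_4 3 = 4" by (simp_all add: index_4_def)
      then show thesis using that[of 0] that[of 1] that[of 2] that[of 3] exhaust_4[of l] by auto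
    qed
    let ?S = "{..<4} - {k}" and ?f = "\<lambda>i j. Poly_Mapping.single (quad_monomial i j) (v $ index_4 i * v $ index_4 j)"
    have "sum_of_squares_of_k_nomials 4 3 (\<Sum>i\<in>?S. \<Sum>j\<in>?S. ?f i j)"
      by (rule sos_linear_form_square[where v = "\<lambda>i. v $ index_4 i"]) (use k in auto)
    also have "(\<Sum>i\<in>?S. \<Sum>j\<in>?S. ?f i j) = (\<Sum>i\<in>?S. \<Sum>j<4. ?f i j)"
      by (intro sum.cong[OF refl] sum.mono_neutral_left) (use k v in auto)
    also have "\<dots> = (\<Sum>i<4. \<Sum>j<4. ?f i j)"
      by (rule sum.mono_neutral_left) (use k v in auto)
    finally show ?thesis by (simp add: quad_poly_def outer_square_def)
  qed
  then have "outer_square ` {v. norm v = 1 \<and> (\<exists>i. v $ i = 0)} \<subseteq> ?P" by blast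
  moreover have scale: "c *\<^sub>R A \<in> ?P" if "A \<in> ?P" "0 \<le> c" for c A
    using sos_quad_poly_scale that by simp
  have add: "A + B \<in> ?P" if "A \<in> ?P" "B \<in> ?P" for A B
    using sos_k_nomial_add that by (simp add: quad_poly_add)
  have "convex ?P"
    unfolding convex_def using scale add by blast
  ultimately have "convex hull (outer_square ` {v. norm v = 1 \<and> (\<exists>i. v $ i = 0)}) \<subseteq> ?P"
    by (intro hull_minimal)
  moreover have "conic ?P" unfolding conic_def using scale by blast
  ultimately have "factor_width_cone \<subseteq> ?P"
    unfolding factor_width_cone_def by (rule hull_minimal)
  then show ?thesis using assms by blast
qed

lemma sos_quaternary_trinomials_of_G_power_mult:
  assumes sos: "sum_of_squares_of_k_nomials 4 3 (G 4 ^ r * quad_poly 4 a)"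
    and sym: "\<And>i j. a i j = a j i"
  shows "sum_of_squares_of_k_nomials 4 3 (quad_poly 4 a)"
proof -
  \<comment> \<open>\<open>\<nu>\<close> inverts \<open>index_4\<close> on
    \<open>0, 1, 2, 3\<close>.\<close>
  define \<nu> :: "4 \<Rightarrow> nat" where "\<nu> l = (if l = 1 then 0 else if l = 2 then 1 else if l = 3 then 2 else 3)" for l
  define Q :: "real^4^4" where "Q = (\<chi> i j. a (\<nu> i) (\<nu> j))"
  have \<nu>: "\<nu> 1 = 0" "\<nu> 2 = 1" "\<nu> 3 = 2" "\<nu> 4 = 3" by (simp_all add: \<nu>_def)
  have Qsym: "transpose Q = Q" using sym by (simp add: Q_def transpose_def vec_eq_iff)
  have four: "(\<Sum>i<4. f i) = f 0 + f 1 + f 2 + f 3" for f :: "nat \<Rightarrow> real"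
    by (simp add: eval_nat_numeral)
  \<comment> \<open>A matrix with such entries pairs with \<open>Q\<close> as a weighted evaluation
    does with the form. This serves the constant weight first and the Klein weight later.\<close>
  have form: "0 \<le> Y \<bullet> Q"
    if w: "psd_weight 4 3 w" and Y: "\<And>i j. Y $ i $ j = w (if \<nu> i = \<nu> j then {} else {\<nu> i, \<nu> j}) * z (\<nu> i) * z (\<nu> j)"
    for w z and Y :: "real^4^4"
  proof -
    have "Y \<bullet> Q = (\<Sum>i<4. \<Sum>j<4. a i j * w (if i = j then {} else {i, j}) * z i * z j)"
      unfolding inner_vec_def sum_4 inner_real_def Y Q_def vec_lambda_beta \<nu> four by (simp add: mult_ac)
    then show ?thesis using weighted_form_nonneg[OF sos w, of z] by simp
  qed
  have Qpsd: "0 \<le> qform Q v" for v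
  proof -
    have "outer_square v $ i $ j = 1 * (v $ index_4 (\<nu> i)) * (v $ index_4 (\<nu> j))" for i j
      using exhaust_4[of i] exhaust_4[of j] by (auto simp: outer_square_def index_4_def \<nu>)
    from form[OF psd_weight_one this] show ?thesis
      by (simp add: inner_outer_square[symmetric] inner_commute)
  qed
  have "Q \<in> factor_width_cone"
  proof (rule ccontr)
    assume "Q \<notin> factor_width_cone"
    have card: "3 \<le> CARD(4)" by simp
    obtain Y0 where "sparse_psd Y0" "Y0 \<bullet> Q < 0"
      using factor_width_cone_separation[OF \<open>Q \<notin> _\<close> Qsym card] by blast
    then obtain Y where Y: "sparse_psd Y" "Y \<bullet> Q < 0" "trace Y = 1"
      and min: "\<And>Z :: real^4^4. sparse_psd Z \<Longrightarrow> (Y \<bullet> Q) * trace Z \<le> Z \<bullet> Q"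
      using sparse_psd_minimiser[OF _ _ card] by blast
    obtain z1 z2 z3 z4 \<alpha> \<beta> \<gamma> where T: "ternary_psd 1 1 1 \<alpha> \<beta> \<gamma>" and
      y: "Y $ 1 $ 1 = z1\<^sup>2" "Y $ 2 $ 2 = z2\<^sup>2" "Y $ 3 $ 3 = z3\<^sup>2" "Y $ 4 $ 4 = z4\<^sup>2"
      "Y $ 1 $ 2 = \<alpha> * z1 * z2" "Y $ 3 $ 4 = \<alpha> * z3 * z4" "Y $ 1 $ 3 = \<beta> * z1 * z3"
      "Y $ 2 $ 4 = \<beta> * z2 * z4" "Y $ 2 $ 3 = \<gamma> * z2 * z3" "Y $ 1 $ 4 = \<gamma> * z1 * z4"
      by (rule minimiser_klein_form[OF Qpsd Y min])
    have Ysym: "transpose Y = Y" using Y(1) by (simp add: sparse_psd_def)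
    note y' = transpose_nth[OF Ysym, of 2 1] transpose_nth[OF Ysym, of 3 1] transpose_nth[OF Ysym, of 4 1]
      transpose_nth[OF Ysym, of 3 2] transpose_nth[OF Ysym, of 4 2] transpose_nth[OF Ysym, of 4 3]
    define z where "z i = (if i = 0 then z1 else if i = 1 then z2 else if i = 2 then z3 else z4)" for i :: nat
    let ?w = "klein_weight \<alpha> \<beta> \<gamma>"
    have "Y $ i $ j = ?w (if \<nu> i = \<nu> j then {} else {\<nu> i, \<nu> j}) * z (\<nu> i) * z (\<nu> j)" for i j
      using exhaust_4[of i] exhaust_4[of j]
      by (auto simp: \<nu> y y' z_def klein_weight_def power2_eq_square)
    \<comment> \<open>The minimiser itself comes from an admissible weight, so it cannot separate
      \<open>Q\<close>.\<close>
    from form[OF psd_weight_klein[OF T] this] show False using Y(2) by simp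
  qed
  then have "sum_of_squares_of_k_nomials 4 3 (quad_poly 4 (\<lambda>i j. Q $ index_4 i $ index_4 j))"
    by (rule sos_of_factor_width_cone)
  also have "quad_poly 4 (\<lambda>i j. Q $ index_4 i $ index_4 j) = quad_poly 4 a"
  proof (rule quad_poly_cong)
    have "\<nu> (index_4 i) = i" if "i < 4" for i
      using that by (auto simp: index_4_def \<nu> less_Suc_eq eval_nat_numeral)
    then show "Q $ index_4 i $ index_4 j = a i j" if "i < 4" "j < 4" for i j
      using that by (simp add: Q_def)
  qed
  finally show ?thesis .
qed

theorem theorem1p1:
  fixes n k :: nat and p :: rpoly
  assumes "n \<ge> 1" and "k \<ge> 1"
    and "quadratic_form n p"
    and "symmetric_poly n p \<or> k = 2 \<or> (n = 4 \<and> k = 3)"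
  shows "(\<exists>r::nat. sum_of_squares_of_k_nomials n k (G n ^ r * p))
           \<longleftrightarrow> sum_of_squares_of_k_nomials n k p"
proof
  let ?q = "quad_poly n (form_matrix p)"
  have p: "?q = p" by (rule quadratic_form_eq_quad_poly[OF assms(3), symmetric])
  assume "\<exists>r::nat. sum_of_squares_of_k_nomials n k (G n ^ r * p)"
  then obtain r where "sum_of_squares_of_k_nomials n k (G n ^ r * p)" by blast
  then have sos: "sum_of_squares_of_k_nomials n k (G n ^ r * ?q)" by (simp only: p)
  from assms(4) consider "symmetric_poly n p" | "k = 2" | "n = 4" "k = 3" by blast
  then have "sum_of_squares_of_k_nomials n k ?q"
  proof cases
    case 1
    obtain \<alpha> \<beta> where "\<And>i j. i < n \<Longrightarrow> j < n \<Longrightarrow> form_matrix p i j = (if i = j then \<alpha> else \<beta>)"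
      by (rule symmetric_form_matrix_constant[OF assms(3) 1]) blast
    then have "?q = quad_poly n (symmetric_matrix \<alpha> \<beta>)"
      by (intro quad_poly_cong) (simp add: symmetric_matrix_def)
    then show ?thesis using sos_symmetric_of_G_power_mult[OF assms(2), of n r \<alpha> \<beta>] sos by simp
  next
    case 2
    show ?thesis
      using sos_binomials_of_G_power_mult[OF sos[unfolded 2] form_matrix_commute] by (simp only: 2)
  next
    case 3
    show ?thesis
      using sos_quaternary_trinomials_of_G_power_mult[OF sos[unfolded 3] form_matrix_commute]
      by (simp only: 3)
  qed
  then show "sum_of_squares_of_k_nomials n k p" by (simp only: p)
next
  assume "sum_of_squares_of_k_nomials n k p"
  then have "sum_of_squares_of_k_nomials n k (G n ^ 0 * p)" by simp
  then show "\<exists>r::nat. sum_of_squares_of_k_nomials n k (G n ^ r * p)" ..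
qed

end
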